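(* If $G$ is a finite simple graph, then $p_{s,t}(G)\le q_s(G)$ for all $s,t \in V(G)$ (not necessarily distinct).
   Context: For a graph $G$ and (not necessarily distinct) vertices $s,t$, $p_{s,t}(G)$ is the number of distinct paths (no repeated vertices) from $s$ to $t$ in $G$; in particular $p_{s,s}(G)=1$. All logarithms are natural. Let $\rho=(4/3)^{1/4}$. Define $b(0)=b(1)=1$ and $b(k)=((k-1)!\,\rho)^{1/(k-1)}$ for integers $k\ge 2$. Let $\lambda(k)=\log\frac{b(k+1)}{b(k)}$ for $k\ge 2$. Let $\alpha(0)=1$, $\alpha(1)=\sqrt{2/\rho^5}$, $\alpha(2)=2/\rho^3$, $\alpha(3)=\frac{6}{\rho^4 b(3)b(5)}$, and $\alpha(k)=\frac{\alpha(k-1)}{1+k(\lambda(k-1)-\lambda(k))}$ for $k\ge 4$. Let $a(k)=\alpha(k)b(k)$ for every integer $k\ge 0$. For a graph $G$ and a vertex $s$ of $G$, $$q_s(G)=a(\deg(s))\prod_{v\in V(G)\setminus\{s\}} b(\deg(v)).$$ *)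

theory Defs
  imports Complex_Main "Graph_Theory.Pair_Digraph" "Graph_Theory.Vertex_Walk"
begin

text \<open>
  Finite simple graphs are rendered by \<^locale>\<open>pair_graph\<close>: a finite vertex set with a
  finite, symmetric, irreflexive arc relation on it. Every edge is a pair of opposite arcs, so
  the degree of a vertex is its out-degree, and a path is determined by its vertex sequence.
  Paths are directed from \<open>s\<close> to \<open>t\<close>; for \<open>s = t\<close> the only one is \<open>[s]\<close>.
\<close>

definition path_count :: "'v pair_pre_digraph \<Rightarrow> 'v \<Rightarrow> 'v \<Rightarrow> nat" where
  "path_count G s t = card {p. vpath p (with_proj G) \<and> hd p = s \<and> last p = t}"

definition deg :: "'v pair_pre_digraph \<Rightarrow> 'v \<Rightarrow> nat" where
  "deg G v = out_degree (with_proj G) v"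

definition rho :: real where
  "rho = (4/3) powr (1/4)"

definition b_fun :: "nat \<Rightarrow> real" where
  "b_fun k = (if k \<le> 1 then 1 else (fact (k - 1) * rho) powr (1 / real (k - 1)))"

text \<open>The value is only meaningful for \<open>k \<ge> 2\<close>, the only case in which it is used below.\<close>

definition lambda_fun :: "nat \<Rightarrow> real" where
  "lambda_fun k = ln (b_fun (k + 1) / b_fun k)"

fun alpha_fun :: "nat \<Rightarrow> real" where
  "alpha_fun k =
    (if k = 0 then 1
     else if k = 1 then sqrt (2 / rho ^ 5)
     else if k = 2 then 2 / rho ^ 3
     else if k = 3 then 6 / (rho ^ 4 * b_fun 3 * b_fun 5)
     else alpha_fun (k - 1) / (1 + real k * (lambda_fun (k - 1) - lambda_fun k)))"

declare alpha_fun.simps [simp del]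

definition a_fun :: "nat \<Rightarrow> real" where
  "a_fun k = alpha_fun k * b_fun k"

definition q_bound :: "'v pair_pre_digraph \<Rightarrow> 'v \<Rightarrow> real" where
  "q_bound G s = a_fun (deg G s) * (\<Prod>v \<in> pverts G - {s}. b_fun (deg G v))"

end

theory Submission
  imports Defs "HOL-Analysis.Harmonic_Numbers"
begin

text \<open>
  The start vertex is peeled off: for \<open>s \<noteq> t\<close> the number of paths from \<open>s\<close> to \<open>t\<close> is the sum, over the
  neighbours \<open>u\<close> of \<open>s\<close>, of the number of paths from \<open>u\<close> to \<open>t\<close> in \<open>G - s\<close>, and the bound is proved by
  induction on the number of vertices. Write \<open>k\<close> for the degree of \<open>s\<close> and \<open>m\<^sub>u + 1\<close> for the degree of a
  neighbour \<open>u\<close>. If the induction hypothesis could simply be summed over the neighbours, it would remain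
  to show that \<open>S exp (-L) \<le> a(k)\<close>, where \<open>S\<close> is the sum of the \<open>\<alpha>(m\<^sub>u)\<close> and \<open>L\<close> the sum of the
  \<open>\<lambda>(m\<^sub>u)\<close>. Equality holds when all \<open>m\<^sub>u\<close> equal \<open>k\<close>, and the recursion for \<open>\<alpha>\<close> says precisely
  that this point is stationary. With \<open>K = k \<alpha>(k)\<close>, the inequality \<open>x \<le> exp (x - 1)\<close> at \<open>x = S / K\<close>
  decouples the neighbours: it is enough that each \<open>\<alpha>(m) / K - \<lambda>(m)\<close> is at most its value at
  \<open>m = k\<close>. This is so for \<open>k, m \<ge> 2\<close> because \<open>\<lambda>\<close> decreases while \<open>m \<alpha>(m)\<close> increases (\<open>excess_max\<close>).

  Neighbours of degree one and two violate this inequality and are handled combinatorially. A leaf can be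
  deleted, unless it is \<open>t\<close>, in which case there is only one path. If \<open>v\<close> is a neighbour of degree
  two whose other neighbour \<open>w\<close> is not adjacent to \<open>s\<close>, then replacing the path \<open>s v w\<close> by an edge
  keeps the number of paths (to \<open>w\<close> instead, if \<open>v = t\<close>) and does not increase the bound. What remains are tips: vertices \<open>v\<close> of degree two
  adjacent to \<open>s\<close> and to a base \<open>u\<close> which is itself a neighbour of \<open>s\<close> of degree at least three. (A
  pendant triangle and a tip \<open>v = t\<close> are dealt with directly.) If \<open>c\<^sub>u\<close> tips have base \<open>u\<close>, and
  \<open>H\<close> is \<open>G\<close> without \<open>s\<close> and without the tips, then the paths number the sum of
  \<open>(1 + c\<^sub>u) p\<^sub>u\<close>, with \<open>p\<^sub>u\<close> the number of paths from \<open>u\<close> to \<open>t\<close> in \<open>H\<close>, and \<open>u\<close>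
  has degree \<open>m\<^sub>u + 1 + c\<^sub>u\<close> in \<open>G\<close> and \<open>m\<^sub>u\<close> in \<open>H\<close>.

  For each triple \<open>(k, m, c)\<close> with \<open>k \<ge> 2\<close> one of three things happens (\<open>trichotomy\<close>). Either the decoupled
  inequality still holds for that neighbour (\<open>linear_ok\<close>); or the bound leaves enough
  room to remove one tip \<open>v\<close>, using that the paths in \<open>G\<close> number those in \<open>G - v\<close> plus
  \<open>p\<^sub>u\<close> (\<open>tip_removable\<close>); or \<open>u\<close> is the only base and the inequality is checked without
  linearisation (\<open>single_ok\<close>). The constants \<open>\<rho>\<close>, \<open>\<alpha>(1)\<close> and \<open>\<alpha>(3)\<close> are adapted to extremal
  triples: \<open>\<lambda>(2) - \<lambda>(3) = ln \<rho>\<close> makes \<open>(2, 2, 1)\<close> an equality, \<open>\<alpha>(1)\<close> does so for \<open>(1, 2, 0)\<close> and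
  \<open>\<alpha>(3)\<close> for \<open>(3, 2, 2)\<close>. Because of such tight cases the finitely many small triples need numerical
  bounds of about five digits, which come from rational bounds for \<open>ln\<close> and for powers of \<open>b\<close>.
\<close>

section \<open>The functions b and lambda\<close>

lemma rho_pos: "rho > 0"
  by (simp add: rho_def)

lemma rho_pow4: "rho ^ 4 = 4/3"
  by (simp add: rho_def powr_power)

lemma rho_bounds: "1.074569 \<le> rho" "rho \<le> 1.07457"
proof -
  have "(1.074569::real) ^ 4 \<le> rho ^ 4" unfolding rho_pow4 by (simp add: field_simps)
  then show "1.074569 \<le> rho" using rho_pos power_mono_iff by fastforce
  have "rho ^ 4 \<le> (1.07457::real) ^ 4" unfolding rho_pow4 by (simp add: field_simps)
  then show "rho \<le> 1.07457" using rho_pos power_mono_iff by fastforce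
qed

lemma rho_gt_1: "rho > 1"
  using rho_bounds by simp

lemma ln_rho: "ln rho = ln (4/3) / 4"
  by (simp add: rho_def ln_powr)

lemma ln_2_bounds: "0.69314 \<le> ln (2::real)" "ln (2::real) \<le> 0.69315"
  using ln_approx_bounds[of 2 5] by (simp_all add: eval_nat_numeral)

lemma ln_rho_bounds: "0.07192 \<le> ln rho" "ln rho \<le> 0.071921"
  unfolding ln_rho using ln_approx_bounds[of "4/3" 3] by (simp_all add: eval_nat_numeral)

text \<open>
  The ratio \<open>9 / 8\<close> enters through \<open>\<lambda>(3) - \<lambda>(4)\<close>. Its error propagates to every later
  difference of \<open>\<lambda>\<close>, so it is bounded more sharply than the general estimate for these
  logarithms would give.
\<close>

lemma ln_9_8_bounds: "0.11778 \<le> ln (9/8::real)" "ln (9/8::real) \<le> 0.11779"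
  using ln_approx_bounds[of "9/8" 2] by (simp_all add: eval_nat_numeral)

lemma ln_3: "ln (3::real) = 2 * ln 2 - 4 * ln rho"
proof -
  have "ln (4/3::real) = ln 4 - ln 3" by (simp add: ln_div)
  moreover have "ln (4::real) = 2 * ln 2" using ln_realpow[of 2 2] by simp
  ultimately show ?thesis by (simp add: ln_rho field_simps)
qed

lemma b_fun_small [simp]: "b_fun 0 = 1" "b_fun (Suc 0) = 1" "b_fun 1 = 1"
  by (simp_all add: b_fun_def)

lemma b_fun_2: "b_fun 2 = rho"
  using rho_pos by (simp add: b_fun_def)

lemma b_fun_Suc_pow: "k \<ge> 1 \<Longrightarrow> b_fun (Suc k) ^ k = fact k * rho"
  using rho_pos by (simp add: b_fun_def powr_power)

lemma b_fun_ge_1: "b_fun k \<ge> 1"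
proof (cases "k \<le> 1")
  case False
  have "1 * 1 \<le> fact (k - 1) * rho"
    using rho_gt_1 by (intro mult_mono) (auto simp: fact_ge_1)
  then show ?thesis using False by (simp add: b_fun_def ge_one_powr_ge_zero)
qed (simp add: b_fun_def)

lemma b_fun_pos: "b_fun k > 0"
  using b_fun_ge_1[of k] by linarith

lemma ln_b_fun: "k \<ge> 2 \<Longrightarrow> ln (b_fun k) = (ln (fact (k - 1)) + ln rho) / (real k - 1)"
  using rho_pos by (simp add: b_fun_def ln_powr ln_mult of_nat_diff)

lemma lambda_fun_eq: "lambda_fun k = ln (b_fun (Suc k)) - ln (b_fun k)"
  using b_fun_pos[of k] b_fun_pos[of "Suc k"] by (simp add: lambda_fun_def ln_div)

lemma exp_lambda_fun: "exp (lambda_fun k) = b_fun (Suc k) / b_fun k"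
  using b_fun_pos[of k] b_fun_pos[of "Suc k"] by (simp add: lambda_fun_def)

lemma lambda_fun_1: "lambda_fun 1 = ln rho"
  by (simp add: lambda_fun_eq b_fun_2 flip: numeral_2_eq_2)

lemma lambda_fun_2: "lambda_fun 2 = (ln 2 - ln rho) / 2"
  by (simp add: lambda_fun_eq ln_b_fun eval_nat_numeral field_simps)

text \<open>
  The differences of \<open>\<lambda>\<close> drive everything: they appear in the recursion for \<open>\<alpha>\<close>, and they satisfy a
  linear recursion whose inhomogeneous term is the logarithm of a rational number close to 1.
\<close>

definition lambda_gap :: "nat \<Rightarrow> real" where
  "lambda_gap k = lambda_fun (k - 1) - lambda_fun k"

text \<open>
  From \<open>k ln b(k+1) = ln k! + ln \<rho>\<close>: eliminating the factorials between three consecutive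
  values of \<open>ln b\<close> removes \<open>\<rho>\<close> as well.
\<close>

lemma lambda_fun_rec:
  assumes "k \<ge> 3"
  shows "real k * lambda_fun k
    = (real k - 2) * lambda_fun (k - 1) + (ln (real k) - ln (real k - 1))"
proof -
  obtain n where n: "k = n + 3" using assms by (metis add.commute le_Suc_ex)
  define F where "F = ln (fact (n + 2) :: real)"
  have 1: "ln (b_fun (Suc k)) = (F + ln (real n + 3) + ln rho) / (real n + 3)"
    by (subst ln_b_fun) (auto simp: n F_def eval_nat_numeral ln_mult add_ac)
  have 2: "ln (b_fun k) = (F + ln rho) / (real n + 2)"
    by (subst ln_b_fun) (auto simp: n F_def add_ac)
  have "(fact (n + 2) :: real) = (real n + 2) * fact (n + 1)"
    by (simp add: eval_nat_numeral)
  then have "F = ln (real n + 2) + ln (fact (n + 1))"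
    unfolding F_def by (simp add: ln_mult)
  then have 3: "ln (b_fun (k - 1)) = (F - ln (real n + 2) + ln rho) / (real n + 1)"
    by (subst ln_b_fun) (auto simp: n)
  have s: "Suc (k - 1) = k" "real k = real n + 3" using n by auto
  show ?thesis
    unfolding lambda_fun_eq s 1 2 3 by (simp add: divide_simps) (simp add: algebra_simps)
qed

lemma lambda_gap_upper_eq:
  assumes "k \<ge> 3"
  shows "real k * lambda_gap k = 2 * lambda_fun (k - 1) - (ln (real k) - ln (real k - 1))"
  using lambda_fun_rec[OF assms] by (simp add: lambda_gap_def algebra_simps)

lemma lambda_gap_lower_eq:
  assumes "k \<ge> 3"
  shows "(real k - 2) * lambda_gap k = 2 * lambda_fun k - (ln (real k) - ln (real k - 1))"
  using lambda_fun_rec[OF assms] by (simp add: lambda_gap_def algebra_simps)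

text \<open>
  The identity \<open>\<rho>\<^sup>4 = 4 / 3\<close> in disguise. It says that attaching one tip to a base with \<open>m = 2\<close>
  costs exactly what the step from \<open>\<lambda>(2)\<close> to \<open>\<lambda>(3)\<close> gains.
\<close>

lemma lambda_gap_3: "lambda_gap 3 = ln rho"
proof -
  have "ln (3::real) - ln 2 = ln 2 - 4 * ln rho" by (simp add: ln_3)
  with lambda_gap_upper_eq[of 3] show ?thesis by (simp add: lambda_fun_2 field_simps)
qed

lemma lambda_gap_rec:
  assumes "k \<ge> 4"
  shows "real k * lambda_gap k = (real k - 3) * lambda_gap (k - 1)
    + ln ((real k - 1)^2 / (real k * (real k - 2)))"
proof -
  have "ln ((real k - 1)^2 / (real k * (real k - 2)))
      = (ln (real k - 1) - ln (real k - 2)) - (ln (real k) - ln (real k - 1))"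
    using assms by (simp add: ln_div ln_mult ln_realpow)
  then show ?thesis
    using lambda_gap_upper_eq[of k] lambda_gap_lower_eq[of "k - 1"] assms
    by (simp add: of_nat_diff)
qed

text \<open>
  Midpoint and trapezoidal bounds for the integral of \<open>1 / y\<close> over \<open>[x (x - 2), (x - 1)\<^sup>2]\<close>, an interval of
  length 1. The last two bounds are the coarser ones which suffice for inductions.
\<close>

lemma ln_square_ratio_bounds:
  assumes "(x::real) > 2"
  defines "e \<equiv> ln ((x - 1)^2 / (x * (x - 2)))"
  shows "e \<ge> 2 / (2 * (x * (x - 2)) + 1)"
    and "e \<le> (1 / (x * (x - 2)) + 1 / (x - 1)^2) / 2"
    and "e \<le> 1 / (x * (x - 2))" and "e \<ge> 1 / (x - 1)^2"
proof -
  define y where "y = x * (x - 2)"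
  have y: "y > 0" using assms by (simp add: y_def)
  have sq: "(x - 1)^2 = y + 1" by (simp add: y_def power2_eq_square algebra_simps)
  have e: "e = ln (y + 1) - ln y"
    using y unfolding e_def sq y_def[symmetric] by (simp add: ln_div)
  show l: "e \<ge> 2 / (2 * (x * (x - 2)) + 1)"
    using ln_inverse_approx_ge[of y "y + 1"] y unfolding e y_def[symmetric] by simp
  show u: "e \<le> (1 / (x * (x - 2)) + 1 / (x - 1)^2) / 2"
    using ln_inverse_approx_le[of y 1] y unfolding e sq y_def[symmetric]
    by (simp add: inverse_eq_divide)
  have "1 / (y + 1) \<le> 1 / y" using y by (simp add: field_simps)
  then show "e \<le> 1 / (x * (x - 2))" using u unfolding sq y_def[symmetric] by simp
  have "1 / (y + 1) \<le> 2 / (2 * y + 1)" using y by (simp add: field_simps)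
  then show "e \<ge> 1 / (x - 1)^2" using l unfolding sq y_def[symmetric] by simp
qed

text \<open>
  The sharp order of magnitude: this is what makes \<open>m \<alpha>(m)\<close> increasing, as
  \<open>m / (m - 1) \<ge> 1 + m (\<lambda>(m-1) - \<lambda>(m))\<close> is the same inequality.
\<close>

lemma lambda_gap_le:
  assumes "k \<ge> 3"
  shows "lambda_gap k \<le> 1 / (real k * (real k - 1))"
  using assms
proof (induction k rule: dec_induct)
  case base
  show ?case using ln_rho_bounds by (simp add: lambda_gap_3)
next
  case (step n)
  define x where "x = real n"
  have x: "x \<ge> 3" using step by (simp add: x_def)
  have "(x + 1) * lambda_gap (Suc n) = (x - 2) * lambda_gap n + ln (x^2 / ((x + 1) * (x - 1)))"
    using lambda_gap_rec[of "Suc n"] step by (simp add: x_def add_ac)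
  also have "\<dots> \<le> (x - 2) * (1 / (x * (x - 1))) + 1 / ((x + 1) * (x - 1))"
    using step.IH x ln_square_ratio_bounds(3)[of "x + 1"]
    by (intro add_mono mult_left_mono) (auto simp: x_def)
  also have "\<dots> \<le> 1 / x"
    using x by (simp add: divide_simps) (simp add: algebra_simps)
  finally have "lambda_gap (Suc n) * (x + 1) \<le> 1 / x" by (simp only: mult.commute)
  then have "lambda_gap (Suc n) \<le> (1 / x) / (x + 1)" using x by (subst pos_le_divide_eq) auto
  then show ?case by (simp add: x_def add_ac mult.commute)
qed

text \<open>
  A crude lower bound, whose constant is chosen just good enough to show that the differences
  decrease.
\<close>

lemma lambda_gap_ge:
  assumes "k \<ge> 3"
  shows "1 / (3 * real k * (real k - 1)) \<le> lambda_gap k"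
  using assms
proof (induction k rule: dec_induct)
  case base
  show ?case using ln_rho_bounds by (simp add: lambda_gap_3)
next
  case (step n)
  define x where "x = real n"
  have x: "x \<ge> 3" using step by (simp add: x_def)
  have "1 / (3 * x) \<le> (x - 2) * (1 / (3 * x * (x - 1))) + 1 / x^2"
    using x by (simp add: divide_simps power2_eq_square) (simp add: algebra_simps)
  also have "\<dots> \<le> (x - 2) * lambda_gap n + ln (x^2 / ((x + 1) * (x - 1)))"
    using step.IH x ln_square_ratio_bounds(4)[of "x + 1"]
    by (intro add_mono mult_left_mono) (auto simp: x_def)
  also have "\<dots> = (x + 1) * lambda_gap (Suc n)"
    using lambda_gap_rec[of "Suc n"] step by (simp add: x_def add_ac)
  finally have "1 / (3 * x) \<le> lambda_gap (Suc n) * (x + 1)" by (simp only: mult.commute)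
  then have "(1 / (3 * x)) / (x + 1) \<le> lambda_gap (Suc n)" using x by (subst pos_divide_le_eq) auto
  then show ?case by (simp add: x_def add_ac mult_ac)
qed

lemma lambda_gap_pos: "k \<ge> 3 \<Longrightarrow> lambda_gap k > 0"
  by (rule less_le_trans[OF _ lambda_gap_ge]) auto

lemma lambda_gap_Suc_le:
  assumes "k \<ge> 3"
  shows "lambda_gap (Suc k) \<le> lambda_gap k"
proof -
  define x where "x = real k"
  have x: "x \<ge> 3" using assms by (simp add: x_def)
  have "(x + 1) * lambda_gap (Suc k) = (x - 2) * lambda_gap k + ln (x^2 / ((x + 1) * (x - 1)))"
    using lambda_gap_rec[of "Suc k"] assms by (simp add: x_def add_ac)
  also have "\<dots> \<le> (x - 2) * lambda_gap k + 1 / ((x + 1) * (x - 1))"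
    using x ln_square_ratio_bounds(3)[of "x + 1"] by simp
  also have "1 / ((x + 1) * (x - 1)) \<le> 3 * (1 / (3 * x * (x - 1)))"
    using x by (simp add: frac_le)
  also have "\<dots> \<le> 3 * lambda_gap k"
    using lambda_gap_ge[OF assms] by (intro mult_left_mono) (auto simp: x_def)
  finally have "(x + 1) * lambda_gap (Suc k) \<le> (x + 1) * lambda_gap k"
    by (simp add: algebra_simps)
  then show ?thesis using x by simp
qed

lemma lambda_gap_antimono:
  assumes "3 \<le> j" "j \<le> k"
  shows "lambda_gap k \<le> lambda_gap j"
  using assms(2,1) by (induction k rule: dec_induct) (auto intro: order_trans[OF lambda_gap_Suc_le])

text \<open>
  The left-hand side grows by \<open>n ln ((n + 1) / n)\<close> in each step, which is at least \<open>6 / 7\<close> from \<open>n = 3\<close>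
  on.
\<close>

lemma lambda_fun_ge:
  assumes "k \<ge> 3"
  shows "real k * (real k - 1) * lambda_fun k \<ge> (6 * real k - 8) / 7"
  using assms
proof (induction k rule: dec_induct)
  case base
  have "lambda_fun 3 = ln 2 / 2 - 3 / 2 * ln rho"
    using lambda_gap_3 by (simp add: lambda_gap_def lambda_fun_2 field_simps)
  then have "lambda_fun 3 \<ge> 5 / 21" using ln_2_bounds ln_rho_bounds by simp
  then show ?case by simp
next
  case (step n)
  define x where "x = real n"
  have x: "x \<ge> 3" using step by (simp add: x_def)
  have l: "2 / (2 * x + 1) \<le> ln (x + 1) - ln x"
    using ln_inverse_approx_ge[of x "x + 1"] x by (simp add: add_ac)
  have "6 / 7 \<le> x * (2 / (2 * x + 1))" using x by (simp add: field_simps)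
  also have "\<dots> \<le> x * (ln (x + 1) - ln x)" using l x by (intro mult_left_mono) auto
  finally have "(6 * x - 8) / 7 + 6 / 7 \<le> x * (x - 1) * lambda_fun n + x * (ln (x + 1) - ln x)"
    using step.IH unfolding x_def by linarith
  also have "\<dots> = x * ((x - 1) * lambda_fun n + (ln (x + 1) - ln x))"
    by (simp add: algebra_simps)
  also have "(x - 1) * lambda_fun n + (ln (x + 1) - ln x) = (x + 1) * lambda_fun (Suc n)"
    using lambda_fun_rec[of "Suc n"] step by (simp add: x_def add_ac)
  finally show ?case by (simp add: x_def algebra_simps add_divide_distrib diff_divide_distrib)
qed

lemma lambda_fun_pos:
  assumes "k \<ge> 1"
  shows "lambda_fun k > 0"
proof -
  consider "k = 1" | "k = 2" | "k \<ge> 3" using assms by linarith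
  then show ?thesis
  proof cases
    case 1
    then show ?thesis using lambda_fun_1 ln_rho_bounds by simp
  next
    case 2
    then show ?thesis using lambda_fun_2 ln_rho_bounds ln_2_bounds by simp
  next
    case 3
    have "0 < (6 * real k - 8) / 7" using 3 by simp
    then have "0 < real k * (real k - 1) * lambda_fun k" using lambda_fun_ge[OF 3] by linarith
    moreover have "real k * (real k - 1) > 0" using 3 by simp
    ultimately show ?thesis by (simp add: zero_less_mult_iff)
  qed
qed

lemma b_fun_Suc_le: "b_fun k \<le> b_fun (Suc k)"
proof (cases "k = 0")
  case False
  then have "ln (b_fun k) \<le> ln (b_fun (Suc k))"
    using lambda_fun_pos[of k] by (simp add: lambda_fun_eq)
  then show ?thesis using b_fun_pos by simp
qed simp

lemma b_fun_mono: "j \<le> k \<Longrightarrow> b_fun j \<le> b_fun k"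
  by (rule lift_Suc_mono_le[of b_fun]) (rule b_fun_Suc_le)

text \<open>
  Equivalent to \<open>k (\<lambda>(k-1) - \<lambda>(k)) \<le> \<lambda>(k-1)\<close>, the form in which it yields the monotonicity of \<open>a\<close>. The
  induction works because \<open>n ln ((n + 1) / n)\<close> increases with \<open>n\<close>.
\<close>

lemma lambda_fun_le_ln:
  assumes "k \<ge> 2"
  shows "real k * lambda_fun k \<le> (real k - 1) * (ln (real k) - ln (real k - 1))"
  using assms
proof (induction k rule: dec_induct)
  case base
  show ?case using ln_rho_bounds by (simp add: lambda_fun_2)
next
  case (step n)
  define x where "x = real n"
  have x: "x \<ge> 2" using step by (simp add: x_def)
  define l l' where "l = ln x - ln (x - 1)" and "l' = ln (x + 1) - ln x"
  have "l \<le> (1 / (x - 1) + 1 / x) / 2"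
    using ln_inverse_approx_le[of "x - 1" 1] x by (simp add: l_def inverse_eq_divide)
  then have "(x - 1) * l \<le> (x - 1) * ((1 / (x - 1) + 1 / x) / 2)"
    using x by (intro mult_left_mono) auto
  also have "\<dots> \<le> x * (2 / (2 * x + 1))"
    using x by (simp add: divide_simps) (simp add: algebra_simps)
  also have "\<dots> \<le> x * l'"
    using ln_inverse_approx_ge[of x "x + 1"] x by (intro mult_left_mono) (auto simp: l'_def add_ac)
  finally have ll': "(x - 1) * l \<le> x * l'" .
  have "(x + 1) * lambda_fun (Suc n) = (x - 1) * lambda_fun n + l'"
    using lambda_fun_rec[of "Suc n"] step by (simp add: x_def l'_def add_ac)
  also have "x * lambda_fun n \<le> (x - 1) * l" using step.IH by (simp add: x_def l_def)
  then have "lambda_fun n \<le> ((x - 1) * l) / x" using x by (simp add: field_simps)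
  then have "lambda_fun n \<le> l'" using ll' x by (smt (verit) divide_right_mono nonzero_mult_div_cancel_left)
  then have "(x - 1) * lambda_fun n + l' \<le> (x - 1) * l' + l'"
    using x by (intro add_mono mult_left_mono) auto
  finally show ?case by (simp add: x_def l'_def algebra_simps)
qed

lemma lambda_gap_mult_le:
  assumes "k \<ge> 3"
  shows "real k * lambda_gap k \<le> lambda_fun (k - 1)"
proof -
  define x where "x = real k"
  have x: "x \<ge> 3" using assms by (simp add: x_def)
  define l where "l = ln x - ln (x - 1)"
  have g: "(x - 2) * lambda_gap k = 2 * lambda_fun k - l"
    using lambda_gap_lower_eq[OF assms] by (simp add: x_def l_def)
  have "x * lambda_fun k \<le> (x - 1) * l"
    using lambda_fun_le_ln[of k] assms by (simp add: x_def l_def)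
  then have "(x - 1) * (2 * lambda_fun k - l) \<le> (x - 2) * lambda_fun k"
    by (simp add: algebra_simps)
  then have "(x - 2) * ((x - 1) * lambda_gap k) \<le> (x - 2) * lambda_fun k"
    using g by (metis mult.left_commute)
  then have "(x - 1) * lambda_gap k \<le> lambda_fun k"
    using x by simp
  then show ?thesis by (simp add: x_def lambda_gap_def algebra_simps)
qed

section \<open>The gain from lowering a degree\<close>

text \<open>
  The net gain for the bound when the degree of a base drops from \<open>d\<close> to \<open>d - 1\<close> together with the removal
  of a tip, which contributes the factor \<open>\<rho>\<close>.
\<close>

definition b_gain :: "nat \<Rightarrow> real" where
  "b_gain d = b_fun d - b_fun (d - 1) / rho"

text \<open>
  The left-hand side increases by at most \<open>n / (n + 1) < 1\<close> in each step, so the constant is dictated by \<open>k = 4\<close>.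
\<close>

lemma lambda_gap_le_linear:
  assumes "k \<ge> 4"
  shows "real k * (real k - 1) * (real k - 2) * lambda_gap k \<le> real k - 2.818"
  using assms
proof (induction k rule: dec_induct)
  case base
  show ?case
    using lambda_gap_rec[of 4] lambda_gap_3 ln_rho_bounds ln_9_8_bounds by (simp add: power2_eq_square)
next
  case (step n)
  define x where "x = real n"
  have x: "x \<ge> 4" using step by (simp add: x_def)
  have "(x + 1) * lambda_gap (Suc n) = (x - 2) * lambda_gap n + ln (x^2 / ((x + 1) * (x - 1)))"
    using lambda_gap_rec[of "Suc n"] step by (simp add: x_def add_ac)
  also have "\<dots> \<le> (x - 2) * lambda_gap n + 1 / ((x + 1) * (x - 1))"
    using x ln_square_ratio_bounds(3)[of "x + 1"] by simp
  finally have "x * (x - 1) * ((x + 1) * lambda_gap (Suc n))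
      \<le> x * (x - 1) * ((x - 2) * lambda_gap n + 1 / ((x + 1) * (x - 1)))"
    using x by (intro mult_left_mono) auto
  also have "\<dots> = x * (x - 1) * (x - 2) * lambda_gap n + x / (x + 1)"
    using x by (simp add: divide_simps) (simp add: algebra_simps)
  also have "\<dots> \<le> (x - 2.818) + 1"
    using step.IH x by (intro add_mono) (auto simp: x_def)
  finally show ?case by (simp add: x_def algebra_simps)
qed

text \<open>
  With \<open>y = \<lambda>(d)\<close>, this is a first-order form of the inequality \<open>1 - exp (-g) \<le> (exp y - 1) (\<rho> exp y - 1)\<close>
  that expresses \<open>b_gain d \<le> b_gain (d + 1)\<close>. Inserting the linear bounds for \<open>\<lambda>\<close> and its differences
  turns it into a polynomial inequality in \<open>d\<close>.
\<close>

lemma lambda_gap_le_lambda_fun: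
  assumes "d \<ge> 3"
  shows "lambda_gap d \<le> lambda_fun d * (rho * (1 + lambda_fun d) - 1)"
proof -
  define x y g where "x = real d" and "y = lambda_fun d" and "g = lambda_gap d"
  define P T t where "P = x * (x - 1)" and "T = P * y" and "t = (6 * x - 8) / 7"
  have x: "x \<ge> 3" using assms by (simp add: x_def)
  have P: "P > 0" using x by (simp add: P_def)
  have y: "y > 0" using lambda_fun_pos[of d] assms by (simp add: y_def)
  have tT: "t \<le> T"
    using lambda_fun_ge[OF assms] by (simp add: T_def P_def t_def x_def y_def)
  have t: "t > 0" using x by (simp add: t_def)
  have "P * g \<le> 0.0745 * t + 1.0745 * (t * t) / P"
  proof (cases "d = 3")
    case True
    then show ?thesis using ln_rho_bounds lambda_gap_3 by (simp add: P_def g_def t_def x_def)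
  next
    case False
    then have d: "d \<ge> 4" using assms by simp
    define z where "z = x - 4"
    have z: "z \<ge> 0" "x = z + 4" using d by (auto simp: z_def x_def)
    \<comment> \<open>The Taylor expansion at \<open>x = 4\<close>, rounded down and with the quadratic part completed to a square.\<close>
    have "0 \<le> 39.2 * (z - 0.2)^2 + 26.187 * z^3 + 3.129 * z^4 + 1.9 * z + 53"
      using z by (intro add_nonneg_nonneg mult_nonneg_nonneg zero_le_power zero_le_power2) auto
    also have "\<dots> \<le> (x - 2) * 49 * P * (0.0745 * t) + (x - 2) * 49 * (1.0745 * (t * t))
        - 49 * P * (x - 2.818)"
      using z(1) unfolding P_def t_def z(2)
      by (simp add: field_simps power2_eq_square power3_eq_cube power4_eq_xxxx)
    also have "\<dots> = 49 * ((x - 2) * (P * (0.0745 * t) + 1.0745 * (t * t)) - P * (x - 2.818))"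
      by (simp only: ring_distribs mult_ac)
    finally have *: "P * (x - 2.818) \<le> (x - 2) * (P * (0.0745 * t) + 1.0745 * (t * t))"
      by simp
    have "P * (x - 2) * g \<le> x - 2.818"
      using lambda_gap_le_linear[OF d] by (simp add: P_def g_def x_def)
    then have "P * (P * (x - 2) * g) \<le> P * (x - 2.818)"
      using P by (intro mult_left_mono) auto
    with * have "(x - 2) * (P * (P * g)) \<le> (x - 2) * (P * (0.0745 * t) + 1.0745 * (t * t))"
      by (simp add: mult_ac)
    then have "P * (P * g) \<le> P * (0.0745 * t) + 1.0745 * (t * t)"
      using x by simp
    then show ?thesis using P by (simp add: field_simps)
  qed
  also have "\<dots> \<le> 0.0745 * T + 1.0745 * (T * T) / P"
    using tT t P by (intro add_mono divide_right_mono mult_left_mono mult_mono) auto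
  also have "\<dots> = P * (y * (0.0745 + 1.0745 * y))"
    using P by (simp add: T_def field_simps)
  also have "y * (0.0745 + 1.0745 * y) \<le> y * (rho * (1 + y) - 1)"
  proof (rule mult_left_mono)
    have "1.0745 * (1 + y) \<le> rho * (1 + y)"
      using rho_bounds y by (intro mult_right_mono) auto
    then show "0.0745 + 1.0745 * y \<le> rho * (1 + y) - 1" by (simp add: algebra_simps)
  qed (use y in auto)
  then have "P * (y * (0.0745 + 1.0745 * y)) \<le> P * (y * (rho * (1 + y) - 1))"
    by (rule mult_left_mono[OF _ less_imp_le[OF P]])
  finally show ?thesis using P by (simp add: y_def g_def)
qed

lemma b_gain_Suc_ge:
  assumes "d \<ge> 3"
  shows "b_gain d \<le> b_gain (Suc d)"
proof -
  define y x where "y = lambda_fun d" and "x = lambda_fun (d - 1)"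
  have xy: "x = y + lambda_gap d" by (simp add: x_def y_def lambda_gap_def)
  define g where "g = lambda_gap d"
  have y: "y > 0" using lambda_fun_pos[of d] assms by (simp add: y_def)
  have g: "g > 0" using lambda_gap_pos[OF assms] by (simp add: g_def)
  have r: "rho > 1" by (rule rho_gt_1)
  have ey: "y \<le> exp y - 1" "1 + y \<le> exp y" using exp_ge_add_one_self[of y] by linarith+
  have ry: "1 \<le> rho * (1 + y)" using mult_mono[of 1 rho 1 "1 + y"] r y by simp
  have "g \<le> y * (rho * (1 + y) - 1)"
    using lambda_gap_le_lambda_fun[OF assms] by (simp add: y_def g_def)
  also have "\<dots> \<le> (exp y - 1) * (rho * exp y - 1)"
    using y by (intro mult_mono diff_mono mult_left_mono ey order.refl) (use ry r in auto)
  finally have "1 - exp (-g) \<le> (exp y - 1) * (rho * exp y - 1)"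
    using exp_ge_add_one_self[of "-g"] by linarith
  then have "exp y * (1 + rho) \<le> exp y * (rho * exp y) + exp (-g)"
    by (simp add: algebra_simps)
  also have "exp (-g) = exp y * exp (-x)"
    by (simp add: xy g_def flip: exp_add)
  finally have "exp y * (1 + rho) \<le> exp y * (rho * exp y + exp (-x))"
    by (simp add: algebra_simps)
  then have "1 + rho \<le> rho * exp y + exp (-x)"
    by simp
  then have "b_fun d * (1 + rho) \<le> b_fun d * (rho * exp y + exp (-x))"
    using b_fun_pos[of d] by simp
  moreover have "b_fun d * exp y = b_fun (Suc d)"
    using exp_lambda_fun[of d] b_fun_pos[of d] by (simp add: y_def)
  moreover have "b_fun d * exp (-x) = b_fun (d - 1)"
    using exp_lambda_fun[of "d - 1"] b_fun_pos[of d] b_fun_pos[of "d - 1"] assms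
    by (simp add: x_def exp_minus)
  ultimately have "b_fun d * (1 + rho) \<le> rho * b_fun (Suc d) + b_fun (d - 1)"
    by (simp add: algebra_simps)
  then have "rho * b_gain d \<le> rho * b_gain (Suc d)"
    using rho_pos by (simp add: b_gain_def algebra_simps)
  then show ?thesis using rho_pos by simp
qed

lemma b_gain_mono:
  assumes "3 \<le> j" "j \<le> k"
  shows "b_gain j \<le> b_gain k"
  using assms(2,1) by (induction k rule: dec_induct) (auto intro: order_trans[OF _ b_gain_Suc_ge])

section \<open>The functions alpha and a\<close>

lemma alpha_0: "alpha_fun 0 = 1" by (subst alpha_fun.simps) simp
lemma alpha_1: "alpha_fun (Suc 0) = sqrt (2 / rho ^ 5)" by (subst alpha_fun.simps) simp
lemma alpha_2: "alpha_fun 2 = 2 / rho ^ 3" by (subst alpha_fun.simps) simp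
lemma alpha_3: "alpha_fun 3 = 6 / (rho ^ 4 * b_fun 3 * b_fun 5)" by (subst alpha_fun.simps) simp
lemma alpha_rec: "k \<ge> 4 \<Longrightarrow> alpha_fun k = alpha_fun (k - 1) / (1 + real k * lambda_gap k)"
  by (subst alpha_fun.simps) (simp add: lambda_gap_def)

lemma alpha_pos: "alpha_fun k > 0"
proof (induction k)
  case 0
  show ?case by (simp add: alpha_0)
next
  case (Suc n)
  consider "Suc n = 1" | "Suc n = 2" | "Suc n = 3" | "Suc n \<ge> 4" by linarith
  then show ?case
  proof cases
    case 1
    then show ?thesis using rho_pos by (simp add: alpha_1)
  next
    case 2
    show ?thesis unfolding 2 using rho_pos by (simp add: alpha_2)
  next
    case 3
    show ?thesis unfolding 3 using rho_pos b_fun_pos by (simp add: alpha_3)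
  next
    case 4
    have "1 + real (Suc n) * lambda_gap (Suc n) > 0"
      using lambda_gap_pos[of "Suc n"] 4 by (intro add_pos_nonneg mult_nonneg_nonneg) auto
    then show ?thesis using alpha_rec[of "Suc n"] 4 Suc by simp
  qed
qed

text \<open>
  The recursion in the form in which it is a stationarity condition: the increment of \<open>\<alpha>\<close> is
  \<open>k \<alpha>(k)\<close> times the increment of \<open>\<lambda>\<close>.
\<close>

lemma alpha_step:
  assumes "k \<ge> 4"
  shows "alpha_fun (k - 1) = alpha_fun k + real k * alpha_fun k * lambda_gap k"
proof -
  have "1 + real k * lambda_gap k > 0"
    using lambda_gap_pos[of k] assms by (intro add_pos_nonneg mult_nonneg_nonneg) auto
  then show ?thesis using alpha_rec[OF assms] by (simp add: field_simps)
qed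

lemma alpha_Suc_le: "k \<ge> 3 \<Longrightarrow> alpha_fun (Suc k) \<le> alpha_fun k"
  using alpha_step[of "Suc k"] alpha_pos[of "Suc k"] lambda_gap_pos[of "Suc k"] by simp

lemma alpha_antimono:
  assumes "3 \<le> j" "j \<le> k"
  shows "alpha_fun k \<le> alpha_fun j"
  using assms(2,1) by (induction k rule: dec_induct) (auto intro: order_trans[OF alpha_Suc_le])

section \<open>Numerical bounds\<close>

text \<open>
  The roots in the definition of \<open>b\<close> are avoided: comparing \<open>k\<close>-th powers leaves an inequality between
  rational numbers.
\<close>

lemma b_fun_lower:
  assumes "x ^ k \<le> fact k * 1.074569" "k \<ge> 1"
  shows "x \<le> b_fun (Suc k)"
proof (rule power_le_imp_le_base[of x "k - 1" "b_fun (Suc k)"])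
  note assms(1)
  also have "fact k * 1.074569 \<le> fact k * rho"
    using rho_bounds by (intro mult_left_mono) auto
  finally show "x ^ Suc (k - 1) \<le> b_fun (Suc k) ^ Suc (k - 1)"
    using assms(2) b_fun_Suc_pow[of k] by simp
qed (use b_fun_pos in \<open>auto simp: less_imp_le\<close>)

lemma b_fun_upper:
  assumes "fact k * 1.07457 \<le> x ^ k" "0 \<le> x" "k \<ge> 1"
  shows "b_fun (Suc k) \<le> x"
proof (rule power_le_imp_le_base[of _ "k - 1" x])
  have "fact k * rho \<le> fact k * (1.07457::real)"
    using rho_bounds by (intro mult_left_mono) auto
  also note assms(1)
  finally show "b_fun (Suc k) ^ Suc (k - 1) \<le> x ^ Suc (k - 1)"
    using assms(3) b_fun_Suc_pow[of k] by simp
qed (use assms in auto)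

lemma b_fun_bounds:
  "1.46598 \<le> b_fun 3" "b_fun 3 \<le> 1.466"
  "1.8612 \<le> b_fun 4" "b_fun 4 \<le> 1.86122"
  "2.25351 \<le> b_fun 5" "b_fun 5 \<le> 2.25353"
  "2.6429 \<le> b_fun 6" "b_fun 6 \<le> 2.64292"
  "3.02989 \<le> b_fun 7" "b_fun 7 \<le> 3.02991"
  "3.41491 \<le> b_fun 8" "b_fun 8 \<le> 3.41493"
  "3.79833 \<le> b_fun 9"
  "b_fun 10 \<le> 4.18045" "4.56141 \<le> b_fun 11"
  subgoal using b_fun_lower[of "1.46598" 2] by (simp add: fact_numeral power_divide)
  subgoal using b_fun_upper[of 2 "1.466"] by (simp add: fact_numeral power_divide)
  subgoal using b_fun_lower[of "1.8612" 3] by (simp add: fact_numeral power_divide)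
  subgoal using b_fun_upper[of 3 "1.86122"] by (simp add: fact_numeral power_divide)
  subgoal using b_fun_lower[of "2.25351" 4] by (simp add: fact_numeral power_divide)
  subgoal using b_fun_upper[of 4 "2.25353"] by (simp add: fact_numeral power_divide)
  subgoal using b_fun_lower[of "2.6429" 5] by (simp add: fact_numeral power_divide)
  subgoal using b_fun_upper[of 5 "2.64292"] by (simp add: fact_numeral power_divide)
  subgoal using b_fun_lower[of "3.02989" 6] by (simp add: fact_numeral power_divide)
  subgoal using b_fun_upper[of 6 "3.02991"] by (simp add: fact_numeral power_divide)
  subgoal using b_fun_lower[of "3.41491" 7] by (simp add: fact_numeral power_divide)
  subgoal using b_fun_upper[of 7 "3.41493"] by (simp add: fact_numeral power_divide)
  subgoal using b_fun_lower[of "3.79833" 8] by (simp add: fact_numeral power_divide)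
  subgoal using b_fun_upper[of 9 "4.18045"] by (simp add: fact_numeral power_divide)
  subgoal using b_fun_lower[of "4.56141" 10] by (simp add: fact_numeral power_divide)
  done

lemma lambda_gap_4: "lambda_gap 4 = (ln rho + ln (9/8)) / 4"
  using lambda_gap_rec[of 4] lambda_gap_3 by (simp add: power2_eq_square)

lemma lambda_gap_step_bounds:
  assumes "k \<ge> 4" "lambda_gap (k - 1) \<in> {lo..hi}"
    and "real k * lo' \<le> (real k - 3) * lo + 2 / (2 * (real k * (real k - 2)) + 1)"
    and "(real k - 3) * hi + (1 / (real k * (real k - 2)) + 1 / (real k - 1)^2) / 2 \<le> real k * hi'"
  shows "lambda_gap k \<in> {lo'..hi'}"
proof -
  define e where "e = ln ((real k - 1)^2 / (real k * (real k - 2)))"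
  have e: "2 / (2 * (real k * (real k - 2)) + 1) \<le> e"
      "e \<le> (1 / (real k * (real k - 2)) + 1 / (real k - 1)^2) / 2"
    using ln_square_ratio_bounds(1,2)[of "real k"] assms(1) unfolding e_def by auto
  have r: "real k * lambda_gap k = (real k - 3) * lambda_gap (k - 1) + e"
    using lambda_gap_rec[OF assms(1)] by (simp add: e_def)
  have "(real k - 3) * lo \<le> (real k - 3) * lambda_gap (k - 1)"
      "(real k - 3) * lambda_gap (k - 1) \<le> (real k - 3) * hi"
    using assms(1,2) by (auto intro!: mult_left_mono)
  then have "real k * lo' \<le> real k * lambda_gap k" "real k * lambda_gap k \<le> real k * hi'"
    using r e assms(3,4) by linarith+
  then show ?thesis using assms(1) by simp
qed

lemma lambda_gap_bounds:
  shows "lambda_gap 4 \<in> {0.047425..0.047428}"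
    and "lambda_gap 5 \<in> {0.031873..0.031888}"
    and "lambda_gap 6 \<in> {0.022739..0.02275}"
    and "lambda_gap 7 \<in> {0.017017..0.017025}"
    and "lambda_gap 8 \<in> {0.013212..0.013219}"
    and "lambda_gap 9 \<in> {0.010557..0.010563}"
proof -
  show 4: "lambda_gap 4 \<in> {0.047425..0.047428}"
    unfolding lambda_gap_4 using ln_rho_bounds ln_9_8_bounds by simp
  show 5: "lambda_gap 5 \<in> {0.031873..0.031888}"
    by (rule lambda_gap_step_bounds[of 5 "0.047425" "0.047428"]) (use 4 in \<open>simp_all add: power2_eq_square\<close>)
  show 6: "lambda_gap 6 \<in> {0.022739..0.02275}"
    by (rule lambda_gap_step_bounds[of 6 "0.031873" "0.031888"]) (use 5 in \<open>simp_all add: power2_eq_square\<close>)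
  show 7: "lambda_gap 7 \<in> {0.017017..0.017025}"
    by (rule lambda_gap_step_bounds[of 7 "0.022739" "0.02275"]) (use 6 in \<open>simp_all add: power2_eq_square\<close>)
  show 8: "lambda_gap 8 \<in> {0.013212..0.013219}"
    by (rule lambda_gap_step_bounds[of 8 "0.017017" "0.017025"]) (use 7 in \<open>simp_all add: power2_eq_square\<close>)
  show "lambda_gap 9 \<in> {0.010557..0.010563}"
    by (rule lambda_gap_step_bounds[of 9 "0.013212" "0.013219"]) (use 8 in \<open>simp_all add: power2_eq_square\<close>)
qed

lemma rho_sq_bounds: "1.15469 \<le> rho ^ 2" "rho ^ 2 \<le> 1.15471"
  using power_mono[OF rho_bounds(1), of 2] power_mono[OF rho_bounds(2), of 2] rho_pos
  by (simp_all add: power_divide)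

lemma rho_cube_bounds: "1.2407 \<le> rho ^ 3" "rho ^ 3 \<le> 1.2409"
  using power_mono[OF rho_bounds(1), of 3] power_mono[OF rho_bounds(2), of 3] rho_pos
  by (simp_all add: power_divide)

lemma alpha_1_sq: "alpha_fun 1 ^ 2 = 3 / (2 * rho)"
proof -
  have "rho ^ 5 = rho ^ 4 * rho" by (simp add: eval_nat_numeral)
  then show ?thesis using rho_pos by (simp add: alpha_1 rho_pow4 field_simps)
qed

lemma alpha_1_bounds: "1.1814 \<le> alpha_fun 1" "alpha_fun 1 \<le> 1.1816"
proof -
  have *: "1.1814 ^ 2 \<le> alpha_fun 1 ^ 2" "alpha_fun 1 ^ 2 \<le> 1.1816 ^ 2"
    unfolding alpha_1_sq using rho_pos rho_bounds by (simp_all add: field_simps power_divide)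
  show "1.1814 \<le> alpha_fun 1"
    by (rule power2_le_imp_le[OF *(1)]) (use alpha_pos[of 1] in simp)
  show "alpha_fun 1 \<le> 1.1816"
    by (rule power2_le_imp_le[OF *(2)]) simp
qed

lemma alpha_2_bounds: "1.6117 \<le> alpha_fun 2" "alpha_fun 2 \<le> 1.612"
  unfolding alpha_2 using rho_cube_bounds rho_pos by (simp_all add: field_simps)

text \<open>
  The factor \<open>\<rho>\<^sup>4\<close> is rational, so \<open>a(3) = 9 / (2 b(5))\<close> involves only one irrational number.
\<close>

lemma alpha_3_eq: "alpha_fun 3 = 9 / (2 * b_fun 3 * b_fun 5)"
  by (simp add: alpha_3 rho_pow4)

lemma alpha_3_bounds: "alpha_fun 3 \<in> {1.36211..1.36216}"
proof -
  have "1.46598 * 2.25351 \<le> b_fun 3 * b_fun 5" "b_fun 3 * b_fun 5 \<le> 1.466 * 2.25353"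
    using b_fun_bounds b_fun_pos[of 3] by (intro mult_mono; simp)+
  moreover have "b_fun 3 * b_fun 5 > 0" using b_fun_pos by simp
  ultimately show ?thesis unfolding alpha_3_eq by (simp add: field_simps)
qed

lemma alpha_step_bounds:
  assumes "k \<ge> 4" "alpha_fun (k - 1) \<in> {lo..hi}" "lambda_gap k \<in> {glo..ghi}"
    and "lo' * (1 + real k * ghi) \<le> lo" "hi \<le> hi' * (1 + real k * glo)" "0 \<le> lo'" "0 \<le> hi'"
  shows "alpha_fun k \<in> {lo'..hi'}"
proof -
  define t where "t = 1 + real k * lambda_gap k"
  have g: "lambda_gap k > 0" using assms(1) by (intro lambda_gap_pos) auto
  then have t: "t > 0" by (simp add: t_def add_pos_nonneg)
  have e: "alpha_fun (k - 1) = alpha_fun k * t"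
    using alpha_step[OF assms(1)] by (simp add: t_def algebra_simps)
  have "t \<le> 1 + real k * ghi" "1 + real k * glo \<le> t"
    using assms(3) by (auto simp: t_def intro!: mult_left_mono)
  then have "lo' * t \<le> lo' * (1 + real k * ghi)" "hi' * (1 + real k * glo) \<le> hi' * t"
    using assms(6,7) by (auto intro: mult_left_mono)
  then have "lo' * t \<le> alpha_fun k * t" "alpha_fun k * t \<le> hi' * t"
    using assms(2,4,5) e by auto
  then show ?thesis using t by simp
qed

lemma alpha_bounds:
  shows "alpha_fun 4 \<in> {1.1449..1.14497}"
    and "alpha_fun 5 \<in> {0.98745..0.98759}"
    and "alpha_fun 6 \<in> {0.86885..0.86903}"
    and "alpha_fun 7 \<in> {0.77633..0.77654}"
    and "alpha_fun 8 \<in> {0.702..0.7025}"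
proof -
  show 4: "alpha_fun 4 \<in> {1.1449..1.14497}"
    by (rule alpha_step_bounds[where lo = "1.36211" and hi = "1.36216", OF _ _ lambda_gap_bounds(1)]) (use alpha_3_bounds in simp_all)
  show 5: "alpha_fun 5 \<in> {0.98745..0.98759}"
    by (rule alpha_step_bounds[where lo = "1.1449" and hi = "1.14497", OF _ _ lambda_gap_bounds(2)]) (use 4 in simp_all)
  show 6: "alpha_fun 6 \<in> {0.86885..0.86903}"
    by (rule alpha_step_bounds[where lo = "0.98745" and hi = "0.98759", OF _ _ lambda_gap_bounds(3)]) (use 5 in simp_all)
  show 7: "alpha_fun 7 \<in> {0.77633..0.77654}"
    by (rule alpha_step_bounds[where lo = "0.86885" and hi = "0.86903", OF _ _ lambda_gap_bounds(4)]) (use 6 in simp_all)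
  show "alpha_fun 8 \<in> {0.702..0.7025}"
    by (rule alpha_step_bounds[where lo = "0.77633" and hi = "0.77654", OF _ _ lambda_gap_bounds(5)]) (use 7 in simp_all)
qed

section \<open>Monotonicity of a\<close>

lemma a_0: "a_fun 0 = 1" by (simp add: a_fun_def alpha_0)
lemma a_1: "a_fun 1 = alpha_fun 1" by (simp add: a_fun_def)
lemma a_2: "a_fun 2 = 2 / rho ^ 2"
  using rho_pos unfolding a_fun_def alpha_2 b_fun_2 by (simp add: power2_eq_square power3_eq_cube)
lemma a_3: "a_fun 3 = 9 / (2 * b_fun 5)"
  using b_fun_pos[of 3] by (simp add: a_fun_def alpha_3_eq)

lemma a_pos: "a_fun k > 0"
  using alpha_pos b_fun_pos by (simp add: a_fun_def)

lemma a_2_3_bounds: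
  "a_fun 2 \<in> {1.73203..1.73207}" "a_fun 3 \<in> {1.99686..1.99689}"
  unfolding a_2 a_3 using rho_sq_bounds b_fun_bounds rho_pos b_fun_pos[of 5]
  by (simp_all add: field_simps)

lemma a_step_bounds:
  assumes "alpha_fun k \<in> {lo..hi}" "blo \<le> b_fun k" "b_fun k \<le> bhi"
    and "0 \<le> lo" "0 \<le> blo" "lo' \<le> lo * blo" "hi * bhi \<le> hi'"
  shows "a_fun k \<in> {lo'..hi'}"
proof -
  have "lo * blo \<le> alpha_fun k * b_fun k" "alpha_fun k * b_fun k \<le> hi * bhi"
    using assms b_fun_pos[of k] alpha_pos[of k] by (auto intro!: mult_mono)
  then show ?thesis using assms by (simp add: a_fun_def)
qed

lemma a_bounds:
  shows "a_fun 4 \<in> {2.1308..2.1311}" and "a_fun 5 \<in> {2.2252..2.2256}"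
    and "a_fun 6 \<in> {2.2962..2.2968}" and "a_fun 7 \<in> {2.3521..2.3529}"
proof -
  show "a_fun 4 \<in> {2.1308..2.1311}"
    by (rule a_step_bounds[OF alpha_bounds(1) b_fun_bounds(3,4)]) simp_all
  show "a_fun 5 \<in> {2.2252..2.2256}"
    by (rule a_step_bounds[OF alpha_bounds(2) b_fun_bounds(5,6)]) simp_all
  show "a_fun 6 \<in> {2.2962..2.2968}"
    by (rule a_step_bounds[OF alpha_bounds(3) b_fun_bounds(7,8)]) simp_all
  show "a_fun 7 \<in> {2.3521..2.3529}"
    by (rule a_step_bounds[OF alpha_bounds(4) b_fun_bounds(9,10)]) simp_all
qed

text \<open>
  For \<open>k \<ge> 3\<close> the quotient \<open>a(k+1) / a(k)\<close> is \<open>exp (\<lambda>(k))\<close> divided by \<open>1 + (k + 1) (\<lambda>(k) - \<lambda>(k+1))\<close>, and the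
  second summand of the denominator is at most \<open>\<lambda>(k)\<close>.
\<close>

lemma a_Suc_le: "a_fun k \<le> a_fun (Suc k)"
proof -
  consider "k = 0" | "k = 1" | "k = 2" | "k \<ge> 3" by linarith
  then show ?thesis
  proof cases
    case 1
    then show ?thesis using a_0 a_1 alpha_1_bounds by simp
  next
    case 2
    then show ?thesis using a_1 alpha_1_bounds a_2_3_bounds by (simp add: numeral_2_eq_2)
  next
    case 3
    then show ?thesis using a_2_3_bounds by (simp add: eval_nat_numeral)
  next
    case 4
    have "1 + real (Suc k) * lambda_gap (Suc k) \<le> 1 + lambda_fun k"
      using lambda_gap_mult_le[of "Suc k"] 4 by simp
    also have "\<dots> \<le> exp (lambda_fun k)" by (rule exp_ge_add_one_self)
    finally have "1 + real (Suc k) * lambda_gap (Suc k) \<le> b_fun (Suc k) / b_fun k"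
      by (simp add: exp_lambda_fun)
    then have "(1 + real (Suc k) * lambda_gap (Suc k)) * b_fun k \<le> b_fun (Suc k)"
      using b_fun_pos[of k] by (simp add: field_simps)
    then have "alpha_fun (Suc k) * ((1 + real (Suc k) * lambda_gap (Suc k)) * b_fun k)
        \<le> alpha_fun (Suc k) * b_fun (Suc k)"
      using alpha_pos[of "Suc k"] by (intro mult_left_mono) auto
    then show ?thesis using alpha_step[of "Suc k"] 4 by (simp add: a_fun_def algebra_simps)
  qed
qed

lemma a_mono: "j \<le> k \<Longrightarrow> a_fun j \<le> a_fun k"
  by (rule lift_Suc_mono_le[of a_fun]) (rule a_Suc_le)

lemma a_ge_1: "a_fun k \<ge> 1"
  using a_mono[of 0 k] a_0 by simp

section \<open>The decoupled inequality for a single neighbour\<close>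

text \<open>
  Going from \<open>m - 1\<close> to \<open>m\<close> changes \<open>\<alpha>(m) / S - \<lambda>(m)\<close> by \<open>- (\<lambda>(m-1) - \<lambda>(m)) (m \<alpha>(m) / S - 1)\<close>. Since
  \<open>m \<alpha>(m)\<close> increases, the sign can only switch once, at \<open>m \<alpha>(m) = S\<close>.
\<close>

lemma excess_decreasing:
  assumes "3 \<le> j" "j \<le> m" "0 < S" "S \<le> real j * alpha_fun j"
  shows "alpha_fun m / S - lambda_fun m \<le> alpha_fun j / S - lambda_fun j"
    and "real j * alpha_fun j \<le> real m * alpha_fun m"
proof -
  have "alpha_fun m / S - lambda_fun m \<le> alpha_fun j / S - lambda_fun j
      \<and> real j * alpha_fun j \<le> real m * alpha_fun m"
    using assms(2,1,3,4)
  proof (induction m rule: dec_induct)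
    case (step n)
    define x g A where "x = real n" and "g = lambda_gap (Suc n)" and "A = alpha_fun (Suc n)"
    have x: "x \<ge> 3" using step by (simp add: x_def)
    have A: "A > 0" by (simp add: A_def alpha_pos)
    have e: "alpha_fun n = A + (x + 1) * A * g"
      using alpha_step[of "Suc n"] step by (simp add: x_def g_def A_def add_ac)
    have g: "0 < g" using lambda_gap_pos[of "Suc n"] step by (simp add: g_def)
    have "g \<le> 1 / ((x + 1) * x)"
      using lambda_gap_le[of "Suc n"] step by (simp add: g_def x_def add_ac)
    moreover have "(x + 1) * x > 0" using x by simp
    ultimately have "(x + 1) * x * g \<le> 1" by (simp only: pos_le_divide_eq mult.commute)
    then have "A * ((x + 1) * x * g) \<le> A * 1" using A by (intro mult_left_mono) auto
    then have K: "x * alpha_fun n \<le> (x + 1) * A" by (simp add: e algebra_simps)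
    have S: "S \<le> (x + 1) * A" using K step by (simp add: x_def)
    have l: "lambda_fun n - lambda_fun (Suc n) = g" by (simp add: g_def lambda_gap_def)
    have "1 \<le> (x + 1) * A / S" using S step.prems by simp
    then have "1 * g \<le> ((x + 1) * A / S) * g" using g by (intro mult_right_mono) auto
    also have "\<dots> = (alpha_fun n - A) / S" by (simp add: e)
    finally have "A / S - lambda_fun (Suc n) \<le> alpha_fun n / S - lambda_fun n"
      using l by (simp add: diff_divide_distrib)
    moreover have "real j * alpha_fun j \<le> x * alpha_fun n" using step by (simp add: x_def)
    ultimately show ?case using step K by (auto simp: A_def x_def add_ac)
  qed simp
  then show "alpha_fun m / S - lambda_fun m \<le> alpha_fun j / S - lambda_fun j"
    and "real j * alpha_fun j \<le> real m * alpha_fun m" by auto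
qed

lemma excess_increasing:
  assumes "3 \<le> m" "m \<le> k" "real k * alpha_fun k \<le> S"
  shows "alpha_fun m / S - lambda_fun m \<le> alpha_fun k / S - lambda_fun k"
  using assms(2,1,3)
proof (induction m rule: inc_induct)
  case (step n)
  define g A where "g = lambda_gap (Suc n)" and "A = alpha_fun (Suc n)"
  have A: "A > 0" by (simp add: A_def alpha_pos)
  have e: "alpha_fun n = A + real (Suc n) * A * g"
    using alpha_step[of "Suc n"] step by (simp add: g_def A_def)
  have g: "0 < g" using lambda_gap_pos[of "Suc n"] step by (simp add: g_def)
  have "real (Suc n) * A \<le> real k * alpha_fun k"
    unfolding A_def using step alpha_pos[of "Suc n"]
    by (intro excess_decreasing(2)[of "Suc n" k "real (Suc n) * alpha_fun (Suc n)"]) auto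
  then have S: "real (Suc n) * A \<le> S" using step by simp
  have S0: "S > 0" by (rule less_le_trans[OF _ S]) (use A in simp)
  have l: "lambda_fun n - lambda_fun (Suc n) = g" by (simp add: g_def lambda_gap_def)
  have "(alpha_fun n - A) / S = (real (Suc n) * A / S) * g" by (simp add: e)
  also have "\<dots> \<le> 1 * g" using S g S0 by (intro mult_right_mono) (auto simp del: of_nat_Suc)
  finally have "alpha_fun n / S - lambda_fun n \<le> A / S - lambda_fun (Suc n)"
    using l by (simp add: diff_divide_distrib)
  then show ?case using step by (simp add: A_def)
qed simp

text \<open>
  The constant \<open>3.3\<close> only has to exceed \<open>2 \<alpha>(2)\<close>: the step from \<open>m = 2\<close> to \<open>m = 3\<close> is not governed by the
  recursion for \<open>\<alpha>\<close> and is therefore compared numerically.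
\<close>

lemma alpha_drop: "ln rho * 3.3 \<le> alpha_fun 2 - alpha_fun 3"
  using ln_rho_bounds alpha_2_bounds alpha_3_bounds by simp

text \<open>
  The heart of the decoupling: among all \<open>m \<ge> 2\<close> the tangent at \<open>S = k \<alpha>(k)\<close> is worst at \<open>m = k\<close>.
\<close>

lemma excess_max:
  assumes "k \<ge> 2" "m \<ge> 2"
  shows "alpha_fun m / (real k * alpha_fun k) - lambda_fun m \<le> 1 / real k - lambda_fun k"
proof -
  define S where "S = real k * alpha_fun k"
  have S: "S > 0" using alpha_pos[of k] assms by (simp add: S_def)
  have k: "alpha_fun k / S = 1 / real k" using alpha_pos[of k] by (simp add: S_def)
  have l: "lambda_fun 2 = lambda_fun 3 + ln rho"
    using lambda_gap_3 by (simp add: lambda_gap_def)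
  have a3: "3 * alpha_fun 3 \<le> S" if "k \<ge> 3"
    unfolding S_def using excess_decreasing(2)[of 3 k "alpha_fun 3"] that alpha_pos[of 3] by simp
  have *: "alpha_fun m / S - lambda_fun m \<le> 1 / real k - lambda_fun k" if "m \<ge> 3" "k \<ge> 3"
  proof (cases "m \<le> k")
    case True
    then show ?thesis using excess_increasing[of m k S] that k by (simp add: S_def)
  next
    case False
    then show ?thesis using excess_decreasing(1)[of k m S] that k S by (simp add: S_def)
  qed
  consider "k \<ge> 3" "m \<ge> 3" | "k \<ge> 3" "m = 2" | "k = 2" "m = 2" | "k = 2" "m \<ge> 3"
    using assms by linarith
  then have "alpha_fun m / S - lambda_fun m \<le> 1 / real k - lambda_fun k"
  proof cases
    case 1
    then show ?thesis by (intro *) auto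
  next
    case 2
    have "alpha_fun 2 - alpha_fun 3 \<le> ln rho * (3 * alpha_fun 3)"
      using alpha_2_bounds alpha_3_bounds ln_rho_bounds mult_mono[of "0.07192" "ln rho" "4.08" "3 * alpha_fun 3"] by simp
    also have "\<dots> \<le> ln rho * S" using a3[OF 2(1)] ln_rho_bounds by (intro mult_left_mono) auto
    finally have "(alpha_fun 2 - alpha_fun 3) / S \<le> ln rho" using S by (simp add: field_simps)
    then have "alpha_fun 2 / S - lambda_fun 2 \<le> alpha_fun 3 / S - lambda_fun 3"
      unfolding l by (simp add: diff_divide_distrib)
    also have "alpha_fun 3 / S - lambda_fun 3 \<le> 1 / real k - lambda_fun k"
      using excess_increasing[of 3 k S] 2 k by (simp add: S_def)
    finally show ?thesis by (simp add: 2)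
  next
    case 3
    then show ?thesis using k by simp
  next
    case 4
    have S2: "S = 2 * alpha_fun 2" using 4 by (simp add: S_def)
    have "ln rho * S \<le> ln rho * 3.3"
      using alpha_2_bounds ln_rho_bounds by (intro mult_left_mono) (auto simp: S2)
    also note alpha_drop
    finally have "ln rho \<le> (alpha_fun 2 - alpha_fun 3) / S" using S by (simp add: field_simps)
    then have "alpha_fun 3 / S - lambda_fun 3 \<le> 1 / 2 - lambda_fun 2"
      using k 4 unfolding l by (simp add: diff_divide_distrib)
    then have "alpha_fun 3 / S - lambda_fun 3 \<le> 1 / real k - lambda_fun k"
      by (simp add: 4)
    moreover have "S \<le> 3 * alpha_fun 3" using alpha_2_bounds alpha_3_bounds by (simp add: S2)
    ultimately show ?thesis using excess_decreasing(1)[of 3 m S] 4 S by simp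
  qed
  then show ?thesis by (simp add: S_def)
qed

text \<open>
  A start vertex with one neighbour. Here the extremal case is \<open>m = 2\<close> instead of \<open>m = k\<close>, so the tangent
  is taken at \<open>S = \<alpha>(2)\<close>; the value of \<open>\<alpha>(1)\<close> makes it an equality.
\<close>

lemma a_1_bound:
  assumes "m \<ge> 2"
  shows "a_fun m \<le> a_fun 1 * b_fun (Suc m)"
proof -
  define S where "S = alpha_fun 2"
  have S: "S > 0" by (simp add: S_def alpha_pos)
  have l: "lambda_fun 2 = lambda_fun 3 + ln rho"
    using lambda_gap_3 by (simp add: lambda_gap_def)
  have "alpha_fun m / S - lambda_fun m \<le> 1 - lambda_fun 2"
  proof (cases "m = 2")
    case True
    then show ?thesis using S by (simp add: S_def)
  next
    case False
    then have m: "m \<ge> 3" using assms by simp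
    have "ln rho * S \<le> ln rho * 3.3"
      using alpha_2_bounds ln_rho_bounds by (intro mult_left_mono) (auto simp: S_def)
    also note alpha_drop
    finally have "ln rho \<le> (alpha_fun 2 - alpha_fun 3) / S" using S by (simp add: field_simps)
    then have "alpha_fun 3 / S - lambda_fun 3 \<le> 1 - lambda_fun 2"
      using S unfolding l by (simp add: diff_divide_distrib S_def)
    moreover have "S \<le> 3 * alpha_fun 3" using alpha_2_bounds alpha_3_bounds by (simp add: S_def)
    ultimately show ?thesis using excess_decreasing(1)[of 3 m S] m S by simp
  qed
  then have "exp (alpha_fun m / S - 1) \<le> exp (lambda_fun m - lambda_fun 2)" by simp
  moreover have "alpha_fun m / S \<le> exp (alpha_fun m / S - 1)"
    using exp_ge_add_one_self[of "alpha_fun m / S - 1"] by simp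
  ultimately have "alpha_fun m / S \<le> exp (lambda_fun m - lambda_fun 2)" by linarith
  also have "\<dots> = (b_fun (Suc m) / b_fun m) * (b_fun 2 / b_fun 3)"
    by (simp add: exp_diff exp_lambda_fun)
  finally have "alpha_fun m \<le> (b_fun (Suc m) / b_fun m) * (b_fun 2 / b_fun 3) * S"
    using S by (simp only: pos_divide_le_eq)
  then have "alpha_fun m * b_fun m \<le> (b_fun (Suc m) / b_fun m) * (b_fun 2 / b_fun 3) * S * b_fun m"
    using b_fun_pos[of m] by (intro mult_right_mono) auto
  also have "\<dots> = S * (b_fun 2 / b_fun 3) * b_fun (Suc m)"
    using b_fun_pos[of m] by simp
  also have "S * (b_fun 2 / b_fun 3) = alpha_fun 1"
  proof (rule power2_eq_imp_eq)
    have "b_fun 3 ^ 2 = 2 * rho" using b_fun_Suc_pow[of 2] by simp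
    then have "(S * (b_fun 2 / b_fun 3))^2 = 4 * rho^2 / (rho^6 * (2 * rho))"
      by (simp add: S_def alpha_2 b_fun_2 power_mult_distrib power_divide flip: power_mult)
    also have "\<dots> = 2 / (rho^4 * rho)" using rho_pos by (simp add: field_simps eval_nat_numeral)
    also have "\<dots> = alpha_fun 1 ^ 2" using alpha_1_sq by (simp add: rho_pow4)
    finally show "(S * (b_fun 2 / b_fun 3))^2 = alpha_fun 1 ^ 2" .
    show "0 \<le> S * (b_fun 2 / b_fun 3)" using S b_fun_pos by (simp add: less_imp_le)
    show "0 \<le> alpha_fun 1" using alpha_pos[of 1] by simp
  qed
  finally show ?thesis by (simp add: a_fun_def)
qed

text \<open>
  The per-neighbour excess of \<open>\<alpha>(m) / (k \<alpha>(k))\<close> over the budget \<open>1 / k - \<lambda>(k)\<close>. All budgets together add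
  up to \<open>1 - k \<lambda>(k)\<close>, which is the value at the extremal point.
\<close>

definition excess :: "nat \<Rightarrow> nat \<Rightarrow> real" where
  "excess k m = alpha_fun m / (real k * alpha_fun k) - (1 / real k - lambda_fun k)"

text \<open>
  The step from \<open>k - 1\<close> to \<open>k\<close> changes the excess by a nonpositive multiple of \<open>\<alpha>(m) - \<alpha>(k-1)\<close>. Hence a numerical check for one small \<open>k\<close> settles all larger ones.
\<close>

lemma excess_antimono:
  assumes "3 \<le> j" "j \<le> k" "alpha_fun m \<ge> alpha_fun j"
  shows "excess k m \<le> excess j m"
  using assms(2,1,3)
proof (induction k rule: dec_induct)
  case (step n)
  define x g A y where "x = real n" and "g = lambda_gap (Suc n)" and "A = alpha_fun (Suc n)"
    and "y = alpha_fun m"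
  have x: "x \<ge> 3" using step by (simp add: x_def)
  have A: "A > 0" by (simp add: A_def alpha_pos)
  have g: "0 < g" using lambda_gap_pos[of "Suc n"] step by (simp add: g_def)
  define B t where "B = alpha_fun n" and "t = 1 + (x + 1) * g"
  have t: "t > 0" using x g by (simp add: t_def add_pos_pos)
  have e: "B = A * t"
    using alpha_step[of "Suc n"] step by (simp add: x_def g_def A_def B_def t_def algebra_simps)
  have B: "B > 0" by (simp add: B_def alpha_pos)
  have yB: "B \<le> y" using alpha_antimono[of j n] step by (simp add: y_def B_def)
  have l: "lambda_fun n = lambda_fun (Suc n) + g" by (simp add: g_def lambda_gap_def)
  have "g \<le> 1 / ((x + 1) * x)"
    using lambda_gap_le[of "Suc n"] step by (simp add: g_def x_def add_ac)
  then have q: "g - 1 / ((x + 1) * x) \<le> 0" by simp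
  have "y / ((x + 1) * A) - y / (x * B) = (y / B) * (t / (x + 1) - 1 / x)"
    using A t x by (simp add: e right_diff_distrib mult_ac)
  also have "t / (x + 1) - 1 / x = g - 1 / ((x + 1) * x)"
    using x by (simp add: t_def divide_simps) (simp add: algebra_simps)
  also have "(y / B) * (g - 1 / ((x + 1) * x)) \<le> 1 * (g - 1 / ((x + 1) * x))"
    using q yB B by (intro mult_right_mono_neg) auto
  also have "\<dots> = g + 1 / (x + 1) - 1 / x"
    using x by (simp add: divide_simps) (simp add: algebra_simps)
  finally have "excess (Suc n) m \<le> excess n m"
    unfolding excess_def l using x by (simp add: x_def A_def B_def y_def add_ac)
  then show ?case using step by simp
qed simp

section \<open>Neighbours with tips\<close>

text \<open>
  A base with \<open>c\<close> tips uses up \<open>c + 1\<close> of the budgets. Its degree \<open>m + 1 + c\<close> and the tips contribute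
  the factor \<open>b(m+1+c) / b(m)\<close>, the exponential of the sum, and \<open>\<rho>\<^sup>c\<close>.
\<close>

definition linear_ok :: "nat \<Rightarrow> nat \<Rightarrow> nat \<Rightarrow> bool" where
  "linear_ok k m c \<longleftrightarrow> real (Suc c) * excess k m
     \<le> (\<Sum>i\<le>c. lambda_fun (m + i)) + real c * ln rho"

text \<open>
  The bound allows for \<open>p(G) = p(G - v) + p(H)\<close> with \<open>v\<close> one of the \<open>c\<close> tips: in \<open>G - v\<close> the start vertex and
  the base lose one degree each, and \<open>H\<close> lacks the other \<open>c - 1\<close> tips.
\<close>

definition tip_removable :: "nat \<Rightarrow> nat \<Rightarrow> nat \<Rightarrow> bool" where
  "tip_removable k m c \<longleftrightarrow>
     a_fun (k - 1) * b_fun (m + c) + a_fun m / rho ^ (c - 1) \<le> a_fun k * b_fun (m + 1 + c) * rho"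

text \<open>
  The whole inequality when all neighbours of \<open>s\<close> are one base and its tips, so that \<open>k = c + 1\<close>.
\<close>

definition single_ok :: "nat \<Rightarrow> nat \<Rightarrow> nat \<Rightarrow> bool" where
  "single_ok k m c \<longleftrightarrow>
     real (Suc c) * a_fun m \<le> a_fun k * b_fun (m + 1 + c) * rho ^ c"

text \<open>
  Replacing \<open>a(k-1)\<close> by \<open>a(k)\<close> leaves a condition whose right-hand side increases with \<open>k\<close>, \<open>c\<close> and \<open>m\<close> once
  \<open>m + c \<ge> 2\<close>, so that infinitely many triples follow from lower bounds \<open>A\<close>, \<open>B\<close>, \<open>C\<close> for one of them.
\<close>

lemma tip_removable_of_gain:
  assumes "c \<ge> 1" "A \<le> a_fun k" "B \<le> rho ^ c" "C \<le> b_gain (m + 1 + c)"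
    "0 \<le> A" "0 \<le> B" "0 \<le> C" "a_fun m \<le> A * B * C"
  shows "tip_removable k m c"
proof -
  obtain n where c: "c = Suc n" using assms(1) by (cases c) auto
  have "A * B * C \<le> a_fun k * rho ^ c * b_gain (m + 1 + c)"
    using assms a_pos[of k] rho_pos by (intro mult_mono) auto
  then have "a_fun m \<le> rho ^ n * (rho * a_fun k * b_gain (m + 1 + c))"
    using assms(8) by (simp add: c mult_ac)
  then have "a_fun m / rho ^ n \<le> rho * a_fun k * b_gain (m + 1 + c)"
    using rho_pos by (simp add: field_simps)
  also have "\<dots> = a_fun k * b_fun (m + 1 + c) * rho - a_fun k * b_fun (m + c)"
    using rho_pos by (simp add: b_gain_def algebra_simps)
  finally have "a_fun k * b_fun (m + c) + a_fun m / rho ^ n \<le> a_fun k * b_fun (m + 1 + c) * rho"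
    by simp
  moreover have "a_fun (k - 1) * b_fun (m + c) \<le> a_fun k * b_fun (m + c)"
    using b_fun_pos[of "m + c"] by (intro mult_right_mono a_mono) auto
  ultimately show ?thesis by (simp add: tip_removable_def c)
qed

text \<open>
  Bounding the excess by \<open>\<lambda>(m)\<close>, a condition independent of \<open>k\<close> remains: the decrease of \<open>\<lambda>\<close> caused by the
  tips has to be paid for by their factors \<open>\<rho>\<close>.
\<close>

lemma linear_ok_of_gaps:
  assumes "k \<ge> 2" "m \<ge> 2" "(\<Sum>i\<le>c. lambda_fun m - lambda_fun (m + i)) \<le> real c * ln rho"
  shows "linear_ok k m c"
proof -
  have "excess k m \<le> lambda_fun m" using excess_max[OF assms(1,2)] by (simp add: excess_def)
  then have "real (Suc c) * excess k m \<le> real (Suc c) * lambda_fun m"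
    by (intro mult_left_mono) auto
  also have "\<dots> = (\<Sum>i\<le>c. lambda_fun m - lambda_fun (m + i)) + (\<Sum>i\<le>c. lambda_fun (m + i))"
    by (simp add: sum_subtractf)
  finally show ?thesis using assms(3) by (simp add: linear_ok_def)
qed

lemma linear_ok_of_bound:
  assumes "excess k m \<le> x" "real (Suc c) * x \<le> (\<Sum>i\<le>c. lambda_fun (m + i)) + real c * ln rho"
  shows "linear_ok k m c"
proof -
  have "real (Suc c) * excess k m \<le> real (Suc c) * x"
    using assms(1) by (intro mult_left_mono) auto
  then show ?thesis using assms(2) unfolding linear_ok_def by linarith
qed

lemma excess_le:
  assumes "alpha_fun m \<le> A" "B \<le> alpha_fun k" "0 < B" "k \<ge> 1" "A \<le> q * (real k * B)"
  shows "excess k m \<le> q - 1 / real k + lambda_fun k"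
proof -
  have "alpha_fun m / (real k * alpha_fun k) \<le> A / (real k * B)"
    using assms alpha_pos[of m] by (intro frac_le mult_left_mono) auto
  also have "\<dots> \<le> q" using assms by (simp add: pos_divide_le_eq)
  finally show ?thesis by (simp add: excess_def)
qed

lemma lambda_fun_chain:
  "lambda_fun 2 = lambda_fun 3 + ln rho" "lambda_fun 3 = lambda_fun 4 + lambda_gap 4"
  "lambda_fun 4 = lambda_fun 5 + lambda_gap 5" "lambda_fun 5 = lambda_fun 6 + lambda_gap 6"
  "lambda_fun 6 = lambda_fun 7 + lambda_gap 7" "lambda_fun 7 = lambda_fun 8 + lambda_gap 8"
  using lambda_gap_3 by (simp_all add: lambda_gap_def)

text \<open>
  \<open>\<lambda>(m) - \<lambda>(m+i)\<close> is at most \<open>1 / m - 1 / (m + i)\<close>, and thus at most \<open>1 / (2 m) \<le> 1 / 14 < ln \<rho>\<close> when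
  \<open>i \<le> m\<close>.
\<close>

lemma linear_ok_long:
  assumes "k \<ge> 2" "m \<ge> 7" "c + 2 \<le> m"
  shows "linear_ok k m c"
proof (rule linear_ok_of_gaps)
  have drop: "lambda_fun m - lambda_fun (m + i) \<le> 1 / real m - 1 / real (m + i)" for i
  proof (induction i)
    case (Suc i)
    have "lambda_fun (m + i) - lambda_fun (m + Suc i) \<le> 1 / (real (m + Suc i) * (real (m + i)))"
      using lambda_gap_le[of "m + Suc i"] assms by (simp add: lambda_gap_def)
    also have "\<dots> = 1 / real (m + i) - 1 / real (m + Suc i)"
      using assms by (simp add: divide_simps)
    finally show ?case using Suc by simp
  qed simp
  have each: "lambda_fun m - lambda_fun (m + i) \<le> ln rho" if "i \<le> c" for i
  proof -
    note drop[of i]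
    also have "1 / real m - 1 / real (m + i) = real i / (real m * real (m + i))"
      using assms by (simp add: divide_simps)
    also have "\<dots> \<le> 1 / (2 * real m)"
      using assms that by (simp add: divide_simps)
    also have "\<dots> \<le> 1 / 14" using assms by (simp add: divide_simps)
    finally show ?thesis using ln_rho_bounds by simp
  qed
  have "(\<Sum>i\<le>c. lambda_fun m - lambda_fun (m + i)) = (\<Sum>i=1..c. lambda_fun m - lambda_fun (m + i))"
    by (intro sum.mono_neutral_right) (auto simp: Suc_le_eq)
  also have "\<dots> \<le> (\<Sum>i=1..c. ln rho)" by (intro sum_mono each) auto
  finally show "(\<Sum>i\<le>c. lambda_fun m - lambda_fun (m + i)) \<le> real c * ln rho" by simp
qed (use assms in auto)

text \<open>
  The differences of \<open>\<lambda>\<close> decrease, so \<open>m = 4\<close> is the worst case.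
\<close>

lemma linear_ok_short:
  assumes "k \<ge> 2" "m \<ge> 4" "c \<le> 5"
  shows "linear_ok k m c"
proof (rule linear_ok_of_gaps)
  define g where "g j = lambda_gap (m + Suc j)" for j
  have g: "g 0 \<le> 0.031888" "g 1 \<le> 0.02275" "g 2 \<le> 0.017025" "g 3 \<le> 0.013219" "g 4 \<le> 0.010563"
    using lambda_gap_antimono[of 5 "m + 1"] lambda_gap_antimono[of 6 "m + 2"]
      lambda_gap_antimono[of 7 "m + 3"] lambda_gap_antimono[of 8 "m + 4"]
      lambda_gap_antimono[of 9 "m + 5"] lambda_gap_bounds assms
    unfolding g_def by (auto simp: numeral_2_eq_2 numeral_3_eq_3 eval_nat_numeral)
  have drop: "lambda_fun m - lambda_fun (m + i) = (\<Sum>j<i. g j)" for i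
    by (induction i) (auto simp: g_def lambda_gap_def)
  have "c \<in> {0, 1, 2, 3, 4, 5}" using assms by auto
  then show "(\<Sum>i\<le>c. lambda_fun m - lambda_fun (m + i)) \<le> real c * ln rho"
    unfolding drop using g ln_rho_bounds by (auto simp: eval_nat_numeral)
qed (use assms in auto)

lemma excess_bounds:
  assumes "alpha_fun m \<le> A" "B \<le> alpha_fun j" "0 < B" "3 \<le> j" "A \<le> q * (real j * B)"
    "j \<le> k" "alpha_fun j \<le> alpha_fun m"
  shows "excess k m \<le> q - 1 / real j + lambda_fun j"
  using excess_antimono[of j k m] excess_le[of m A B j q] assms by simp

text \<open>
  The argument with \<open>m \<ge> 2\<close> does not apply, as \<open>\<alpha>(1)\<close> is exceptional, but \<open>\<alpha>(1) \<ge> \<alpha>(4)\<close> makes the excess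
  decrease from \<open>k = 4\<close> on.
\<close>

lemma linear_ok_1_1:
  assumes "k \<ge> 2"
  shows "linear_ok k 1 1"
proof -
  note l = lambda_fun_1 lambda_fun_chain ln_2_bounds ln_rho_bounds lambda_fun_2 lambda_gap_bounds
  have sum: "(\<Sum>i\<le>1. lambda_fun (1 + i)) = lambda_fun 1 + lambda_fun 2"
    by (simp add: numeral_2_eq_2)
  consider "k = 2" | "k = 3" | "k \<ge> 4" using assms by linarith
  then show ?thesis
  proof cases
    case 1
    have "excess k 1 \<le> 0.37 - 1 / 2 + lambda_fun 2"
      using excess_le[of 1 "1.1816" "1.6117" 2 "0.37"] alpha_1_bounds alpha_2_bounds by (simp add: 1)
    then show ?thesis by (rule linear_ok_of_bound) (use l in \<open>simp add: sum[simplified]\<close>)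
  next
    case 2
    have "excess k 1 \<le> 0.29 - 1 / 3 + lambda_fun 3"
      using excess_le[of 1 "1.1816" "1.36211" 3 "0.29"] alpha_1_bounds alpha_3_bounds by (simp add: 2)
    then show ?thesis by (rule linear_ok_of_bound) (use l in \<open>simp add: sum[simplified]\<close>)
  next
    case 3
    have "excess k 1 \<le> 0.26 - 1 / 4 + lambda_fun 4"
      using excess_bounds[of 1 "1.1816" "1.1449" 4 "0.26" k] alpha_1_bounds alpha_bounds 3 by simp
    then show ?thesis by (rule linear_ok_of_bound) (use l in \<open>simp add: sum[simplified]\<close>)
  qed
qed

lemma linear_ok_2_2:
  assumes "k \<ge> 4"
  shows "linear_ok k 2 2"
proof -
  have "excess k 2 \<le> 0.352 - 1 / 4 + lambda_fun 4"
    using excess_bounds[of 2 "1.612" "1.1449" 4 "0.352" k] alpha_2_bounds alpha_bounds assms by simp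
  then show ?thesis
    by (rule linear_ok_of_bound)
       (use lambda_fun_chain ln_rho_bounds lambda_gap_bounds in \<open>simp add: eval_nat_numeral\<close>)
qed

lemma linear_ok_2_3:
  assumes "k \<ge> 7"
  shows "linear_ok k 2 3"
proof -
  have "excess k 2 \<le> 0.2967 - 1 / 7 + lambda_fun 7"
    using excess_bounds[of 2 "1.612" "0.77633" 7 "0.2967" k] alpha_2_bounds alpha_bounds assms by simp
  then show ?thesis
    by (rule linear_ok_of_bound)
       (use lambda_fun_chain ln_rho_bounds lambda_gap_bounds in \<open>simp add: eval_nat_numeral\<close>)
qed

text \<open>
  A particularly tight numerical check: at \<open>k = 5\<close> the two sides differ by less than \<open>0.001\<close>.
\<close>

lemma linear_ok_3_3:
  assumes "k \<ge> 5"
  shows "linear_ok k 3 3"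
proof -
  have "excess k 3 \<le> 0.2759 - 1 / 5 + lambda_fun 5"
    using excess_bounds[of 3 "1.36216" "0.98745" 5 "0.2759" k] alpha_3_bounds alpha_bounds assms by simp
  then show ?thesis
    by (rule linear_ok_of_bound)
       (use lambda_fun_chain ln_rho_bounds lambda_gap_bounds in \<open>simp add: eval_nat_numeral\<close>)
qed

lemma linear_ok_3_4:
  assumes "k \<ge> 8"
  shows "linear_ok k 3 4"
proof -
  have "excess k 3 \<le> 0.243 - 1 / 8 + lambda_fun 8"
    using excess_bounds[of 3 "1.36216" "0.702" 8 "0.243" k] alpha_3_bounds alpha_bounds assms by simp
  then show ?thesis
    by (rule linear_ok_of_bound)
       (use lambda_fun_chain ln_rho_bounds lambda_gap_bounds in \<open>simp add: eval_nat_numeral\<close>)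
qed

lemma linear_ok_few_tips:
  assumes "k \<ge> 2"
  shows "linear_ok k 2 1" "linear_ok k 3 1" "linear_ok k 3 2"
  by (rule linear_ok_of_gaps;
      use assms lambda_fun_chain ln_rho_bounds lambda_gap_bounds in \<open>simp add: eval_nat_numeral\<close>)+

lemma rho_pow_bounds: "1.4327 \<le> rho ^ 5" "1.5395 \<le> rho ^ 6"
proof -
  have "rho ^ 5 = 4 / 3 * rho" "rho ^ 6 = 4 / 3 * rho ^ 2"
    using rho_pow4 by (simp_all add: eval_nat_numeral)
  then show "1.4327 \<le> rho ^ 5" "1.5395 \<le> rho ^ 6" using rho_bounds rho_sq_bounds by simp_all
qed

lemma rho_pow_mono: "i \<le> j \<Longrightarrow> rho ^ i \<le> rho ^ j"
  using rho_gt_1 by (intro power_increasing) auto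

lemma b_gain_bounds:
  "0.465 \<le> b_gain 3" "0.4967 \<le> b_gain 4" "0.57 \<le> b_gain 7" "0.62 \<le> b_gain 9" "0.67 \<le> b_gain 11"
proof -
  have *: "B \<le> b_gain (Suc n)"
    if "lo \<le> b_fun (Suc n)" "b_fun n \<le> hi" "hi \<le> 1.074569 * (lo - B)" "B \<le> lo" for B n lo hi
  proof -
    have "1.074569 * (lo - B) \<le> rho * (b_fun (Suc n) - B)"
      using that rho_bounds by (intro mult_mono) auto
    then have "b_fun n \<le> rho * (b_fun (Suc n) - B)" using that by linarith
    then show ?thesis using rho_pos by (simp add: b_gain_def field_simps)
  qed
  show "0.465 \<le> b_gain 3"
    using *[of "1.46598" 2 "1.07457" "0.465"] b_fun_bounds b_fun_2 rho_bounds by simp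
  show "0.4967 \<le> b_gain 4"
    using *[of "1.8612" 3 "1.466" "0.4967"] b_fun_bounds by simp
  show "0.57 \<le> b_gain 7"
    using *[of "3.02989" 6 "2.64292" "0.57"] b_fun_bounds by simp
  show "0.62 \<le> b_gain 9"
    using *[of "3.79833" 8 "3.41493" "0.62"] b_fun_bounds by simp
  show "0.67 \<le> b_gain 11"
    using *[of "4.56141" 10 "4.18045" "0.67"] b_fun_bounds by simp
qed

lemma tip_removable_low:
  assumes "k \<ge> Suc c" "c \<ge> 2"
  shows "tip_removable k 0 c"
proof (rule tip_removable_of_gain[where A = "1.99686" and B = "1.15469" and C = "0.465"])
  show "1.99686 \<le> a_fun k" using a_mono[of 3 k] a_2_3_bounds assms by simp
  show "1.15469 \<le> rho ^ c" using rho_pow_mono[of 2 c] rho_sq_bounds assms by simp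
  show "0.465 \<le> b_gain (0 + 1 + c)" using b_gain_mono[of 3 "Suc c"] b_gain_bounds assms by simp
qed (use assms a_0 in auto)

lemma tip_removable_1:
  assumes "k \<ge> 4" "c \<ge> 2"
  shows "tip_removable k 1 c"
proof (rule tip_removable_of_gain[where A = "2.1308" and B = "1.15469" and C = "0.4967"])
  show "2.1308 \<le> a_fun k" using a_mono[of 4 k] a_bounds assms by simp
  show "1.15469 \<le> rho ^ c" using rho_pow_mono[of 2 c] rho_sq_bounds assms by simp
  show "0.4967 \<le> b_gain (1 + 1 + c)" using b_gain_mono[of 4 "c + 2"] b_gain_bounds assms by simp
qed (use assms a_1 alpha_1_bounds in auto)

lemma tip_removable_2:
  assumes "k \<ge> 6" "c \<ge> 4"
  shows "tip_removable k 2 c"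
proof (rule tip_removable_of_gain[where A = "2.2962" and B = "4 / 3" and C = "0.57"])
  show "2.2962 \<le> a_fun k" using a_mono[of 6 k] a_bounds assms by simp
  show "4 / 3 \<le> rho ^ c" using rho_pow_mono[of 4 c] rho_pow4 assms by simp
  show "0.57 \<le> b_gain (2 + 1 + c)" by (rule order_trans[OF b_gain_bounds(3) b_gain_mono]) (use assms in auto)
qed (use assms a_2_3_bounds in auto)

lemma tip_removable_3:
  assumes "k \<ge> 6" "c \<ge> 5"
  shows "tip_removable k 3 c"
proof (rule tip_removable_of_gain[where A = "2.2962" and B = "1.4327" and C = "0.62"])
  show "2.2962 \<le> a_fun k" using a_mono[of 6 k] a_bounds assms by simp
  show "1.4327 \<le> rho ^ c" using rho_pow_mono[of 5 c] rho_pow_bounds assms by simp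
  show "0.62 \<le> b_gain (3 + 1 + c)" by (rule order_trans[OF b_gain_bounds(4) b_gain_mono]) (use assms in auto)
qed (use assms a_2_3_bounds in auto)

text \<open>
  With at least six tips the factor \<open>\<rho>\<^sup>c\<close> times the gain exceeds 1, and \<open>a(m) \<le> a(k)\<close> does the rest.
\<close>

lemma tip_removable_high:
  assumes "c \<ge> 6" "m \<ge> 4" "m \<le> k"
  shows "tip_removable k m c"
proof (rule tip_removable_of_gain[where A = "a_fun k" and B = "1.5395" and C = "0.67"])
  show "1.5395 \<le> rho ^ c" using rho_pow_mono[of 6 c] rho_pow_bounds assms by simp
  show "0.67 \<le> b_gain (m + 1 + c)" using b_gain_mono[of 11 "m + 1 + c"] b_gain_bounds assms by simp
  show "a_fun m \<le> a_fun k * 1.5395 * 0.67" using a_mono[OF assms(3)] a_pos[of k] by simp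
qed (use assms a_pos[of k] in auto)

lemma tip_removable_of_bounds:
  assumes "0 \<le> B" "0 \<le> A" "0 < R'"
    "A \<le> a_fun k" "a_fun (k - 1) \<le> A'" "B \<le> b_fun (m + 1 + c)" "b_fun (m + c) \<le> B'"
    "a_fun m \<le> q" "R' \<le> rho ^ (c - 1)" "A' * B' + q / R' \<le> A * B * 1.074569"
  shows "tip_removable k m c"
proof -
  have "a_fun (k - 1) * b_fun (m + c) \<le> A' * B'"
    using assms a_pos[of "k - 1"] b_fun_pos[of "m + c"] by (intro mult_mono) auto
  moreover have "a_fun m / rho ^ (c - 1) \<le> q / R'"
    using assms a_pos[of m] by (intro frac_le) auto
  moreover have "A * B * 1.074569 \<le> a_fun k * b_fun (m + 1 + c) * rho"
    using assms rho_bounds a_pos[of k] b_fun_pos[of "m + 1 + c"] by (intro mult_mono) auto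
  ultimately show ?thesis using assms(10) unfolding tip_removable_def by linarith
qed

text \<open>
  In these triples the difference between \<open>a(k-1)\<close> and \<open>a(k)\<close> matters.
\<close>

lemma tip_removable_sporadic:
  "tip_removable 5 2 3" "tip_removable 6 2 3" "tip_removable 6 3 4" "tip_removable 7 3 4"
proof -
  note bounds = a_bounds a_2_3_bounds b_fun_bounds rho_sq_bounds rho_cube_bounds
  show "tip_removable 5 2 3"
    by (rule tip_removable_of_bounds[of "2.6429" "2.2252" "1.15469" _ "2.1311" _ _ "2.25353" "1.73207"])
      (use bounds in simp_all)
  show "tip_removable 6 2 3"
    by (rule tip_removable_of_bounds[of "2.6429" "2.2962" "1.15469" _ "2.2256" _ _ "2.25353" "1.73207"])
      (use bounds in simp_all)
  show "tip_removable 6 3 4"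
    by (rule tip_removable_of_bounds[of "3.41491" "2.2962" "1.2407" _ "2.2256" _ _ "3.02991" "1.99689"])
      (use bounds in simp_all)
  show "tip_removable 7 3 4"
    by (rule tip_removable_of_bounds[of "3.41491" "2.3521" "1.2407" _ "2.2968" _ _ "3.02991" "1.99689"])
      (use bounds in simp_all)
qed

lemma single_ok_of_bounds:
  assumes "0 \<le> B" "0 \<le> A" "0 \<le> R"
    "A \<le> a_fun k" "B \<le> b_fun (m + 1 + c)" "a_fun m \<le> q" "R \<le> rho ^ c"
    "real (Suc c) * q \<le> A * B * R"
  shows "single_ok k m c"
proof -
  have "real (Suc c) * a_fun m \<le> real (Suc c) * q" using assms by (intro mult_left_mono) auto
  also note assms(8)
  also have "A * B * R \<le> a_fun k * b_fun (m + 1 + c) * rho ^ c"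
    using assms a_pos[of k] b_fun_pos[of "m + 1 + c"] by (intro mult_mono) auto
  finally show ?thesis by (simp add: single_ok_def)
qed

text \<open>
  For \<open>(3, 2, 2)\<close> equality holds, by the choice of \<open>\<alpha>(3)\<close>.
\<close>

lemma single_ok_small:
  "single_ok 3 1 2" "single_ok 3 2 2" "single_ok 4 2 3" "single_ok 4 3 3" "single_ok 5 2 4" "single_ok 5 3 4"
proof -
  note bounds = a_bounds a_2_3_bounds b_fun_bounds rho_sq_bounds rho_cube_bounds rho_pow4
  show "single_ok 3 1 2"
    by (rule single_ok_of_bounds[of "1.8612" "1.99686" "1.15469" _ _ _ "1.1816"])
      (use bounds a_1 alpha_1_bounds arg_cong[of "1 + 1 + 2" 4 b_fun] in simp_all)
  have "rho ^ 2 * rho ^ 2 = 4 / 3" using rho_pow4 by (simp flip: power_add)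
  then have "real (Suc 2) * a_fun 2 = 9 / 2 * rho ^ 2"
    using rho_pos by (simp add: a_2 field_simps)
  also have "9 / 2 = a_fun 3 * b_fun (2 + 1 + 2)"
    using b_fun_pos[of 5] arg_cong[of "2 + 1 + 2" 5 b_fun] by (simp add: a_3)
  finally show "single_ok 3 2 2" by (simp add: single_ok_def)
  show "single_ok 4 2 3"
    by (rule single_ok_of_bounds[of "2.6429" "2.1308" "1.2407" _ _ _ "1.73207"]) (use bounds in simp_all)
  show "single_ok 4 3 3"
    by (rule single_ok_of_bounds[of "3.02989" "2.1308" "1.2407" _ _ _ "1.99689"]) (use bounds in simp_all)
  show "single_ok 5 2 4"
    by (rule single_ok_of_bounds[of "3.02989" "2.2252" "4/3" _ _ _ "1.73207"]) (use bounds in simp_all)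
  show "single_ok 5 3 4"
    by (rule single_ok_of_bounds[of "3.41491" "2.2252" "4/3" _ _ _ "1.99689"]) (use bounds in simp_all)
qed

text \<open>
  Many tips favour removing one of them, large \<open>m\<close> favours the decoupled inequality; together they cover
  all but a few small triples, which have \<open>k = c + 1\<close>. The hypotheses on \<open>m\<close> say that a base has degree at
  least three.
\<close>

lemma trichotomy:
  assumes "k \<ge> 2" "Suc c \<le> k" "c = 0 \<Longrightarrow> m \<ge> 2" "c = 1 \<Longrightarrow> m \<ge> 1"
  shows "linear_ok k m c \<or> (c \<ge> 1 \<and> tip_removable k m c) \<or> (k = Suc c \<and> single_ok k m c)"
proof -
  consider "c = 0" | "c \<ge> 1" "m = 0" | "c \<ge> 1" "m = 1" | "c \<ge> 1" "m = 2" | "c \<ge> 1" "m = 3"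
    | "m \<ge> 4" "c \<le> 5" | "m \<ge> 4" "c \<ge> 6" "m \<le> Suc c" | "m \<ge> 4" "c \<ge> 6" "m \<ge> c + 2"
    by linarith
  then show ?thesis
  proof cases
    case 1
    then show ?thesis using assms linear_ok_of_gaps[of k m 0] by simp
  next
    case 2
    then have "c \<ge> 2" using assms by force
    then show ?thesis using tip_removable_low[of c k] assms 2 by simp
  next
    case 3
    then consider "c = 1" | "c = 2" "k = 3" | "c \<ge> 2" "k \<ge> 4" using assms by linarith
    then show ?thesis
      by cases (use 3 assms linear_ok_1_1[of k] single_ok_small tip_removable_1[of k c] in auto)
  next
    case 4
    then have "c = 1 \<or> c = 2 \<and> k = 3 \<or> c = 2 \<and> k \<ge> 4 \<or> c = 3 \<and> k = 4 \<or> c = 3 \<and> k = 5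
        \<or> c = 3 \<and> k = 6 \<or> c = 3 \<and> k \<ge> 7 \<or> c = 4 \<and> k = 5 \<or> c \<ge> 4 \<and> k \<ge> 6"
      using assms(2) by presburger
    then show ?thesis
      by (elim disjE conjE) (use 4 assms linear_ok_few_tips linear_ok_2_2 linear_ok_2_3 single_ok_small
          tip_removable_sporadic tip_removable_2 in auto)
  next
    case 5
    then have "c = 1 \<or> c = 2 \<or> c = 3 \<and> k = 4 \<or> c = 3 \<and> k \<ge> 5 \<or> c = 4 \<and> k = 5
        \<or> c = 4 \<and> k = 6 \<or> c = 4 \<and> k = 7 \<or> c = 4 \<and> k \<ge> 8 \<or> c \<ge> 5 \<and> k \<ge> 6"
      using assms(2) by presburger
    then show ?thesis
      by (elim disjE conjE) (use 5 assms linear_ok_few_tips linear_ok_3_3 linear_ok_3_4 single_ok_small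
          tip_removable_sporadic tip_removable_3 in auto)
  next
    case 6
    then show ?thesis using linear_ok_short assms by simp
  next
    case 7
    then show ?thesis using tip_removable_high[of c m k] assms by simp
  next
    case 8
    then show ?thesis using linear_ok_long[of k m c] assms by simp
  qed
qed

section \<open>The inequality for a whole neighbourhood\<close>

lemma exp_linear_terms:
  "exp ((\<Sum>i\<le>c. lambda_fun (m + i)) + real c * ln rho) = b_fun (m + 1 + c) / b_fun m * rho ^ c"
proof -
  have "(\<Sum>i\<le>c. lambda_fun (m + i)) = ln (b_fun (m + 1 + c)) - ln (b_fun m)"
    by (induction c) (auto simp: lambda_fun_eq)
  then show ?thesis
    using b_fun_pos rho_pos by (simp add: exp_add exp_diff exp_of_nat_mult)
qed

text \<open>
  The extremal point: \<open>k\<close> neighbours with \<open>m = k\<close> and without tips give equality.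
\<close>

lemma a_fun_eq_exp:
  assumes "k \<ge> 2"
  shows "real k * alpha_fun k * exp (- (real k * lambda_fun k)) = a_fun k"
proof -
  obtain n where k: "k = Suc (Suc n)" using assms by (auto simp: numeral_2_eq_2 Suc_le_eq dest!: less_imp_Suc_add)
  have "b_fun (Suc k) ^ k = real k * b_fun k ^ Suc n"
    using b_fun_Suc_pow[of k] b_fun_Suc_pow[of "Suc n"] by (simp add: k)
  then have *: "b_fun k ^ k * real k = b_fun k * b_fun (Suc k) ^ k"
    by (simp add: k)
  have "exp (- (real k * lambda_fun k)) = (b_fun k / b_fun (Suc k)) ^ k"
    using b_fun_pos[of k] b_fun_pos[of "Suc k"]
    by (simp add: exp_minus exp_of_nat_mult exp_lambda_fun power_divide)
  also have "\<dots> * real k = b_fun k"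
    using * b_fun_pos[of "Suc k"] by (simp add: power_divide)
  finally have "exp (- (real k * lambda_fun k)) * real k = b_fun k" .
  then show ?thesis by (simp add: a_fun_def mult_ac)
qed

text \<open>
  The decoupling itself. The tangent inequality \<open>S / K \<le> exp (S / K - 1)\<close> converts the sum of the decoupled
  inequalities back into the multiplicative form.
\<close>

lemma linear_ok_sum:
  fixes m c :: "'a \<Rightarrow> nat"
  assumes fin: "finite B" and k: "k = (\<Sum>u\<in>B. Suc (c u))" "k \<ge> 2"
    and ok: "\<And>u. u \<in> B \<Longrightarrow> linear_ok k (m u) (c u)"
  shows "(\<Sum>u\<in>B. real (Suc (c u)) * alpha_fun (m u)) * (\<Prod>u\<in>B. b_fun (m u))
    \<le> a_fun k * (\<Prod>u\<in>B. b_fun (m u + 1 + c u)) * rho ^ (\<Sum>u\<in>B. c u)"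
proof -
  define K where "K = real k * alpha_fun k"
  define S where "S = (\<Sum>u\<in>B. real (Suc (c u)) * alpha_fun (m u))"
  define L where "L u = (\<Sum>i\<le>c u. lambda_fun (m u + i)) + real (c u) * ln rho" for u
  have K: "K > 0" unfolding K_def using k(2) by (intro mult_pos_pos alpha_pos) simp
  have kr: "real k = (\<Sum>u\<in>B. real (Suc (c u)))" by (simp add: k(1))
  have "S / K = (\<Sum>u\<in>B. real (Suc (c u)) * excess k (m u) + real (Suc (c u)) * (1 / real k - lambda_fun k))"
    unfolding S_def sum_divide_distrib
    by (intro sum.cong) (auto simp: excess_def K_def algebra_simps)
  also have "\<dots> = (\<Sum>u\<in>B. real (Suc (c u)) * excess k (m u)) + real k * (1 / real k - lambda_fun k)"
    by (simp only: sum.distrib kr sum_distrib_right)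
  also have "\<dots> \<le> (\<Sum>u\<in>B. L u) + real k * (1 / real k - lambda_fun k)"
    using ok by (intro add_right_mono sum_mono) (auto simp: linear_ok_def L_def)
  also have "real k * (1 / real k - lambda_fun k) = 1 - real k * lambda_fun k"
    using k(2) by (simp add: algebra_simps)
  finally have le: "S / K - 1 \<le> (\<Sum>u\<in>B. L u) + - (real k * lambda_fun k)" by simp
  have "S / K \<le> exp (S / K - 1)" using exp_ge_add_one_self[of "S / K - 1"] by simp
  also have "\<dots> \<le> exp ((\<Sum>u\<in>B. L u) + - (real k * lambda_fun k))" using le by simp
  finally have "S / K \<le> exp (\<Sum>u\<in>B. L u) * exp (- (real k * lambda_fun k))"
    by (simp only: exp_add)
  then have "S \<le> K * (exp (\<Sum>u\<in>B. L u) * exp (- (real k * lambda_fun k)))"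
    using K by (simp only: pos_divide_le_eq mult.commute)
  also have "\<dots> = a_fun k * exp (\<Sum>u\<in>B. L u)"
    using a_fun_eq_exp[OF k(2)] by (simp add: K_def mult_ac)
  also have "exp (\<Sum>u\<in>B. L u) = (\<Prod>u\<in>B. b_fun (m u + 1 + c u) / b_fun (m u) * rho ^ c u)"
    unfolding L_def by (simp only: exp_sum[OF fin] exp_linear_terms)
  finally have "S * (\<Prod>u\<in>B. b_fun (m u))
      \<le> a_fun k * (\<Prod>u\<in>B. b_fun (m u + 1 + c u) / b_fun (m u) * rho ^ c u) * (\<Prod>u\<in>B. b_fun (m u))"
    by (rule mult_right_mono) (simp add: prod_nonneg less_imp_le b_fun_pos)
  also have "\<dots> = a_fun k * ((\<Prod>u\<in>B. b_fun (m u + 1 + c u) / b_fun (m u) * rho ^ c u * b_fun (m u)))"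
    by (simp only: prod.distrib mult.assoc)
  also have "(\<Prod>u\<in>B. b_fun (m u + 1 + c u) / b_fun (m u) * rho ^ c u * b_fun (m u))
      = (\<Prod>u\<in>B. b_fun (m u + 1 + c u) * rho ^ c u)"
    by (intro prod.cong refl) (use b_fun_pos in \<open>simp add: less_imp_neq[THEN not_sym]\<close>)
  finally show ?thesis by (simp add: S_def prod.distrib power_sum mult.assoc)
qed

text \<open>
  Room for the single path from \<open>s\<close> directly to a tip \<open>t\<close> with base of degree \<open>d\<close>. For \<open>k = 2\<close> the growth from
  \<open>a(1)\<close> to \<open>a(2)\<close> provides it; for \<open>k \<ge> 3\<close> a third neighbour of degree at least two contributes a further
  factor \<open>\<rho>\<close>.
\<close>

lemma tip_target_gap:
  assumes "d \<ge> 3"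
  shows "1 \<le> a_fun 2 * b_fun d * rho - a_fun 1 * b_fun (d - 1)"
    and "k \<ge> 3 \<Longrightarrow> 1 \<le> rho * (a_fun k * b_fun d * rho - a_fun (k - 1) * b_fun (d - 1))"
proof -
  have gain: "0.465 \<le> b_gain d" using b_gain_mono[of 3 d] b_gain_bounds assms by simp
  have split: "b_fun (d - 1) = rho * (b_fun d - b_gain d)"
    using rho_pos by (simp add: b_gain_def)
  have b: "1.46598 \<le> b_fun d" using b_fun_mono[of 3 d] b_fun_bounds assms by simp
  have "1 * (1.1814 * 0.465 + 0.55 * 1.46598)
      \<le> rho * (a_fun 1 * b_gain d + (a_fun 2 - a_fun 1) * b_fun d)"
    using rho_gt_1 gain b alpha_1_bounds a_2_3_bounds a_1
    by (intro mult_mono add_mono add_nonneg_nonneg mult_nonneg_nonneg) auto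
  also have "\<dots> = a_fun 2 * b_fun d * rho - a_fun 1 * b_fun (d - 1)"
    unfolding split by (simp add: algebra_simps)
  finally show "1 \<le> a_fun 2 * b_fun d * rho - a_fun 1 * b_fun (d - 1)" by simp
  assume k: "k \<ge> 3"
  have a: "1.99686 \<le> a_fun k" using a_mono[of 3 k] a_2_3_bounds k by simp
  have "1 \<le> 1.15469 * (1.99686 * (0.465 :: real))" by simp
  also have "\<dots> \<le> rho ^ 2 * (a_fun k * b_gain d)"
    using rho_sq_bounds a gain by (intro mult_mono) auto
  also have "\<dots> = rho * (a_fun k * b_fun d * rho - a_fun k * b_fun (d - 1))"
    unfolding split by (simp add: power2_eq_square algebra_simps)
  also have "\<dots> \<le> rho * (a_fun k * b_fun d * rho - a_fun (k - 1) * b_fun (d - 1))"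
    using rho_pos b_fun_pos[of "d - 1"] a_mono[of "k - 1" k]
    by (intro mult_left_mono diff_left_mono mult_right_mono) auto
  finally show "1 \<le> rho * (a_fun k * b_fun d * rho - a_fun (k - 1) * b_fun (d - 1))" .
qed

text \<open>
  The numerical content of the induction step when no tip is removed. A failure of the decoupled inequality
  forces \<open>k = c + 1\<close> for some base, which leaves no room for further bases.
\<close>

lemma neighbourhood_inequality:
  fixes m c :: "'a \<Rightarrow> nat"
  assumes fin: "finite B" and ne: "B \<noteq> {}"
    and c0: "\<And>u. u \<in> B \<Longrightarrow> c u = 0 \<Longrightarrow> m u \<ge> 2"
    and c1: "\<And>u. u \<in> B \<Longrightarrow> c u = 1 \<Longrightarrow> m u \<ge> 1"
    and k: "k = (\<Sum>u\<in>B. Suc (c u))"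
    and no_tip: "\<And>u. u \<in> B \<Longrightarrow> c u \<ge> 1 \<Longrightarrow> \<not> tip_removable k (m u) (c u)"
  shows "(\<Sum>u\<in>B. real (Suc (c u)) * alpha_fun (m u)) * (\<Prod>u\<in>B. b_fun (m u))
    \<le> a_fun k * (\<Prod>u\<in>B. b_fun (m u + 1 + c u)) * rho ^ (\<Sum>u\<in>B. c u)"
proof (cases "k \<ge> 2 \<and> (\<forall>u\<in>B. linear_ok k (m u) (c u))")
  case True
  then show ?thesis by (intro linear_ok_sum fin k) auto
next
  case False
  have le: "Suc (c u) \<le> k" if "u \<in> B" for u
    unfolding k using fin that by (intro member_le_sum) auto
  have single: "B = {u}" if u: "u \<in> B" "k = Suc (c u)" for u
  proof (rule ccontr)
    assume "B \<noteq> {u}"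
    then obtain w where w: "w \<in> B" "w \<noteq> u" using u by auto
    have "(\<Sum>x\<in>{u, w}. Suc (c x)) \<le> k"
      unfolding k using fin u w by (intro sum_mono2) auto
    then show False using u w by simp
  qed
  have "\<exists>u. B = {u} \<and> real (Suc (c u)) * a_fun (m u) \<le> a_fun k * b_fun (m u + 1 + c u) * rho ^ c u"
  proof (cases "k \<ge> 2")
    case True
    then obtain u where u: "u \<in> B" "\<not> linear_ok k (m u) (c u)" using False by auto
    then have "k = Suc (c u) \<and> single_ok k (m u) (c u)"
      using trichotomy[OF True le[OF u(1)], of "m u"] c0 c1 no_tip by auto
    then show ?thesis using single[OF u(1)] by (auto simp: single_ok_def)
  next
    case False
    obtain u where u: "u \<in> B" using ne by auto
    then have "k = 1" "c u = 0" using le[OF u] False by auto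
    then show ?thesis
      using a_1_bound[of "m u"] c0[OF u] single[OF u] by (auto simp: a_fun_def)
  qed
  then show ?thesis by (auto simp: a_fun_def mult_ac)
qed

section \<open>Counting paths\<close>

text \<open>
  Graphs are represented by an edge relation and a separate vertex set, so that deleting vertices keeps the
  relation and only contractions change it.
\<close>

definition nbrs :: "('v \<Rightarrow> 'v \<Rightarrow> bool) \<Rightarrow> 'v set \<Rightarrow> 'v \<Rightarrow> 'v set" where
  "nbrs E V v = {u \<in> V. E v u}"

definition paths :: "('v \<Rightarrow> 'v \<Rightarrow> bool) \<Rightarrow> 'v set \<Rightarrow> 'v \<Rightarrow> 'v \<Rightarrow> 'v list set" where
  "paths E V s t =
     {p. p \<noteq> [] \<and> distinct p \<and> set p \<subseteq> V \<and> hd p = s \<and> last p = t \<and> successively E p}"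

definition npaths :: "('v \<Rightarrow> 'v \<Rightarrow> bool) \<Rightarrow> 'v set \<Rightarrow> 'v \<Rightarrow> 'v \<Rightarrow> nat" where
  "npaths E V s t = card (paths E V s t)"

lemma finite_paths: "finite V \<Longrightarrow> finite (paths E V s t)"
  by (rule finite_subset[OF _ finite_subset_distinct[of V]]) (auto simp: paths_def)

lemma npaths_same:
  assumes "s \<in> V"
  shows "npaths E V s s = 1"
proof -
  have "paths E V s s = {[s]}"
  proof (intro equalityI subsetI)
    fix p assume p: "p \<in> paths E V s s"
    then obtain q where q: "p = s # q" by (cases p) (auto simp: paths_def)
    have "q = []"
    proof (rule ccontr)
      assume "q \<noteq> []"
      then have "last p \<in> set q" by (simp add: q)
      then show False using p by (auto simp: paths_def q)
    qed
    then show "p \<in> {[s]}" by (simp add: q)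
  qed (use assms in \<open>auto simp: paths_def\<close>)
  then show ?thesis by (simp add: npaths_def)
qed

lemma npaths_outside:
  assumes "s \<notin> V \<or> t \<notin> V"
  shows "npaths E V s t = 0"
proof -
  have "hd p \<in> V \<and> last p \<in> V" if "p \<in> paths E V s t" for p
    using that hd_in_set[of p] last_in_set[of p] by (auto simp: paths_def)
  then have "paths E V s t = {}" using assms by (auto simp: paths_def)
  then show ?thesis by (simp add: npaths_def)
qed

lemma npaths_step:
  assumes "finite V" "s \<in> V" "s \<noteq> t"
  shows "npaths E V s t = (\<Sum>u\<in>nbrs E (V - {s}) s. npaths E (V - {s}) u t)"
proof -
  define N where "N = nbrs E (V - {s}) s"
  have "paths E V s t = (\<Union>u\<in>N. (#) s ` paths E (V - {s}) u t)"
  proof (intro equalityI subsetI)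
    fix p assume p: "p \<in> paths E V s t"
    then obtain q where q: "p = s # q" by (cases p) (auto simp: paths_def)
    with p assms(3) have "q \<noteq> []" by (auto simp: paths_def)
    then have "hd q \<in> set q" by simp
    with p \<open>q \<noteq> []\<close> have "hd q \<in> N" "q \<in> paths E (V - {s}) (hd q) t"
      by (auto simp: paths_def q N_def nbrs_def successively_Cons)
    then show "p \<in> (\<Union>u\<in>N. (#) s ` paths E (V - {s}) u t)" by (auto simp: q)
  next
    fix p assume "p \<in> (\<Union>u\<in>N. (#) s ` paths E (V - {s}) u t)"
    then obtain u q where "u \<in> N" "q \<in> paths E (V - {s}) u t" "p = s # q" by auto
    then show "p \<in> paths E V s t"
      using assms(2) by (auto simp: paths_def N_def nbrs_def successively_Cons)
  qed
  then have "npaths E V s t = card (\<Union>u\<in>N. (#) s ` paths E (V - {s}) u t)"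
    by (simp only: npaths_def)
  also have "\<dots> = (\<Sum>u\<in>N. card ((#) s ` paths E (V - {s}) u t))"
  proof (rule card_UN_disjoint)
    show "finite N" using assms(1) by (simp add: N_def nbrs_def)
    show "\<forall>u\<in>N. finite ((#) s ` paths E (V - {s}) u t)"
      using assms(1) by (simp add: finite_paths)
  qed (auto simp: paths_def)
  finally show ?thesis by (simp add: npaths_def N_def card_image)
qed

lemma npaths_cong:
  assumes "\<And>x y. x \<in> V \<Longrightarrow> y \<in> V \<Longrightarrow> E x y = E' x y"
  shows "npaths E V s t = npaths E' V s t"
proof -
  have "successively E p = successively E' p" if "set p \<subseteq> V" for p
    using that assms by (intro successively_cong) auto
  then have "paths E V s t = paths E' V s t" by (auto simp: paths_def)
  then show ?thesis by (simp add: npaths_def)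
qed

lemma nbrs_mono: "U \<subseteq> V \<Longrightarrow> nbrs E U x \<subseteq> nbrs E V x"
  by (auto simp: nbrs_def)

lemma nbrs_Diff: "nbrs E (V - X) x = nbrs E V x - X"
  by (auto simp: nbrs_def)

lemma nbrs_sym: "symp E \<Longrightarrow> u \<in> nbrs E V v \<Longrightarrow> v \<in> V \<Longrightarrow> v \<in> nbrs E V u"
  by (auto simp: nbrs_def dest: sympD)

lemma not_own_nbr: "irreflp E \<Longrightarrow> v \<notin> nbrs E V v"
  by (auto simp: nbrs_def irreflp_def)

lemma finite_nbrs: "finite V \<Longrightarrow> finite (nbrs E V x)"
  by (simp add: nbrs_def)

lemma npaths_no_nbrs:
  assumes "finite V" "s \<noteq> t" "nbrs E V s = {}"
  shows "npaths E V s t = 0"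
proof (cases "s \<in> V")
  case True
  have "nbrs E (V - {s}) s = {}" using assms(3) nbrs_mono[of "V - {s}" V E s] by auto
  then show ?thesis using npaths_step[OF assms(1) True assms(2), of E] by simp
qed (simp add: npaths_outside)

lemma npaths_isolated_target:
  assumes "finite V" "symp E" "s \<noteq> t" "nbrs E V t = {}"
  shows "npaths E V s t = 0"
  using assms(1,3,4)
proof (induction "card V" arbitrary: V s rule: less_induct)
  case less
  show ?case
  proof (cases "s \<in> V")
    case True
    have "npaths E (V - {s}) u t = 0" if u: "u \<in> nbrs E (V - {s}) s" for u
    proof (rule less.hyps)
      show "u \<noteq> t"
        using u less.prems True sympD[OF assms(2), of s t] by (auto simp: nbrs_def)
      show "card (V - {s}) < card V" using less.prems True by (intro card_Diff1_less) auto
      show "nbrs E (V - {s}) t = {}" using less.prems nbrs_mono[of "V - {s}" V E t] by auto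
    qed (use less.prems in auto)
    then show ?thesis using npaths_step[OF less.prems(1) True less.prems(2), of E] by simp
  qed (simp add: npaths_outside)
qed

text \<open>
  A path cannot pass through a vertex with at most one neighbour. The step case needs the hypothesis with a
  subset rather than an equation, since the neighbour may itself be deleted.
\<close>

lemma npaths_delete_leaf:
  assumes "finite V" "symp E" "s \<noteq> v" "t \<noteq> v" "nbrs E V v \<subseteq> {w}"
  shows "npaths E V s t = npaths E (V - {v}) s t"
  using assms(1,3,5)
proof (induction "card V" arbitrary: V s rule: less_induct)
  case less
  consider "s \<notin> V \<or> t \<notin> V" | "s \<in> V" "t \<in> V" "s = t" | "s \<in> V" "s \<noteq> t" by auto
  then show ?case
  proof cases
    case 1
    then have "s \<notin> V - {v} \<or> t \<notin> V - {v}" by auto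
    from npaths_outside[OF 1] npaths_outside[OF this] show ?thesis by simp
  next
    case 2
    then show ?thesis using less.prems by (simp add: npaths_same)
  next
    case 3
    have IH: "npaths E (V - {s}) u t = npaths E (V - {s} - {v}) u t" if "u \<noteq> v" for u
    proof (rule less.hyps)
      show "card (V - {s}) < card V" using less.prems 3 by (intro card_Diff1_less) auto
      show "nbrs E (V - {s}) v \<subseteq> {w}" using less.prems nbrs_mono[of "V - {s}" V E v] by auto
    qed (use less.prems that in auto)
    have v: "npaths E (V - {s}) v t = 0" if "v \<in> nbrs E (V - {s}) s"
    proof (rule npaths_no_nbrs)
      have "s \<in> nbrs E V v" using that 3 assms(2) by (auto simp: nbrs_def dest: sympD)
      then show "nbrs E (V - {s}) v = {}" using less.prems by (auto simp: nbrs_def)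
    qed (use less.prems assms(4) in auto)
    have "npaths E V s t = (\<Sum>u\<in>nbrs E (V - {s}) s. npaths E (V - {s}) u t)"
      by (rule npaths_step) (use less.prems 3 in auto)
    also have "\<dots> = (\<Sum>u\<in>nbrs E (V - {s}) s - {v}. npaths E (V - {s}) u t)"
      by (rule sum.mono_neutral_right) (use less.prems v in \<open>auto simp: finite_nbrs\<close>)
    also have "\<dots> = (\<Sum>u\<in>nbrs E (V - {v} - {s}) s. npaths E (V - {v} - {s}) u t)"
    proof (rule sum.cong)
      have e: "V - {v} - {s} = V - {s} - {v}" by auto
      show "npaths E (V - {s}) u t = npaths E (V - {v} - {s}) u t"
        if "u \<in> nbrs E (V - {v} - {s}) s" for u
        unfolding e by (rule IH) (use that in \<open>simp add: nbrs_def\<close>)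
    qed (auto simp: nbrs_def)
    also have "\<dots> = npaths E (V - {v}) s t"
      by (rule npaths_step[symmetric]) (use less.prems 3 in auto)
    finally show ?thesis .
  qed
qed

lemma npaths_delete_leaves:
  assumes "finite V" "symp E" "finite D" "s \<notin> D" "t \<notin> D" "\<And>v. v \<in> D \<Longrightarrow> nbrs E V v \<subseteq> {f v}"
  shows "npaths E V s t = npaths E (V - D) s t"
  using assms(3-)
proof (induction D rule: finite_induct)
  case (insert v D)
  have "nbrs E (V - D) v \<subseteq> {f v}"
    using insert.prems(3)[of v] nbrs_mono[of "V - D" V E v] by auto
  then have "npaths E (V - D) s t = npaths E (V - D - {v}) s t"
    by (rule npaths_delete_leaf[rotated 4]) (use insert.prems(1,2) assms(1,2) in auto)
  moreover have "V - D - {v} = V - insert v D" by auto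
  moreover have "npaths E V s t = npaths E (V - D) s t"
    by (rule insert.IH) (use insert.prems in auto)
  ultimately show ?case by simp
qed simp

text \<open>
  A path to a leaf is a path to its neighbour, extended by one edge.
\<close>

lemma npaths_leaf_target:
  assumes "finite V" "symp E" "irreflp E" "s \<noteq> t" "t \<in> V" "nbrs E V t = {w}"
  shows "npaths E V s t = npaths E (V - {t}) s w"
  using assms(1,4-)
proof (induction "card V" arbitrary: V s rule: less_induct)
  case less
  have "w \<in> nbrs E V t" using less.prems by simp
  then have wt: "w \<noteq> t" "w \<in> V" "E w t"
    using assms(2,3) by (auto simp: nbrs_def irreflp_def dest: sympD)
  consider "s \<notin> V" | "s = w" | "s \<in> V" "s \<noteq> w" by blast
  then show ?case
  proof cases
    case 1
    then show ?thesis by (simp add: npaths_outside)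
  next
    case 2
    have "nbrs E (V - {w}) t = {}" using less.prems by (simp add: nbrs_Diff)
    then have *: "npaths E (V - {w}) u t = (if u = t then 1 else 0)" for u
      using less.prems assms(2) wt by (auto simp: npaths_same npaths_isolated_target)
    have "npaths E V s t = (\<Sum>u\<in>nbrs E (V - {w}) w. npaths E (V - {w}) u t)"
      using npaths_step[of V w t E] less.prems wt 2 by simp
    also have "\<dots> = 1" using less.prems wt by (simp add: * finite_nbrs) (simp add: nbrs_def)
    finally show ?thesis using 2 less.prems wt by (simp add: npaths_same)
  next
    case 3
    have "s \<notin> nbrs E V t" using 3 less.prems by simp
    then have nt: "\<not> E s t" using 3 assms(2) by (auto simp: nbrs_def dest: sympD)
    have IH: "npaths E (V - {s}) u t = npaths E (V - {s} - {t}) u w" if "u \<noteq> t" for u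
    proof (rule less.hyps)
      show "card (V - {s}) < card V" using less.prems 3 by (intro card_Diff1_less) auto
      show "nbrs E (V - {s}) t = {w}" using less.prems 3 by (simp add: nbrs_Diff)
    qed (use less.prems that 3 in auto)
    have "npaths E V s t = (\<Sum>u\<in>nbrs E (V - {s}) s. npaths E (V - {s}) u t)"
      by (rule npaths_step) (use less.prems 3 in auto)
    also have "\<dots> = (\<Sum>u\<in>nbrs E (V - {t} - {s}) s. npaths E (V - {t} - {s}) u w)"
    proof (rule sum.cong)
      have e: "V - {t} - {s} = V - {s} - {t}" by auto
      show "npaths E (V - {s}) u t = npaths E (V - {t} - {s}) u w"
        if "u \<in> nbrs E (V - {t} - {s}) s" for u
        unfolding e by (rule IH) (use that in \<open>simp add: nbrs_def\<close>)
    qed (use nt in \<open>auto simp: nbrs_def\<close>)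
    also have "\<dots> = npaths E (V - {t}) s w"
      by (rule npaths_step[symmetric]) (use less.prems 3 in auto)
    finally show ?thesis .
  qed
qed

lemma npaths_split_nbr:
  assumes "finite V" "irreflp E" "s \<in> V" "s \<noteq> t" "v \<in> nbrs E V s"
  shows "npaths E V s t
    = npaths E (V - {s}) v t + (\<Sum>u\<in>nbrs E V s - {v}. npaths E (V - {s}) u t)"
proof -
  have "nbrs E (V - {s}) s = nbrs E V s"
    using not_own_nbr[OF assms(2), of s V] by (simp add: nbrs_Diff)
  then have "npaths E V s t = (\<Sum>u\<in>nbrs E V s. npaths E (V - {s}) u t)"
    using npaths_step[OF assms(1,3,4), of E] by simp
  also have "\<dots> = npaths E (V - {s}) v t + (\<Sum>u\<in>nbrs E V s - {v}. npaths E (V - {s}) u t)"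
    by (rule sum.remove[OF finite_nbrs[OF assms(1)] assms(5)])
  finally show ?thesis .
qed

text \<open>
  Paths starting \<open>s v w\<close> correspond to paths from \<open>w\<close> that avoid \<open>s\<close> and \<open>v\<close>; all other paths avoid \<open>v\<close>,
  which becomes a leaf once \<open>s\<close> is gone.
\<close>

lemma npaths_tip:
  assumes "finite V" "symp E" "irreflp E" "s \<in> V" "s \<noteq> t" "v \<in> V" "nbrs E V v = {s, w}"
    "E s w" "t \<noteq> v"
  shows "npaths E V s t = npaths E (V - {v}) s t + npaths E (V - {s, v}) w t"
proof -
  define W where "W = V - {s, v}"
  have v: "v \<in> nbrs E V s" using nbrs_sym[of E s V v] assms by simp
  have sv: "s \<noteq> v" using v not_own_nbr[OF assms(3)] by metis
  have "w \<in> nbrs E V v" using assms(7) by simp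
  then have w: "w \<in> V" "w \<noteq> s" "w \<noteq> v"
    using assms(3,8) by (auto simp: nbrs_def irreflp_def)
  have W: "W = V - {s} - {v}" "W = V - {v} - {s}" by (auto simp: W_def)
  have nv: "nbrs E (V - {s}) v = {w}" using assms(7) w by (auto simp: nbrs_Diff)
  have "npaths E (V - {s}) v t = (\<Sum>u\<in>nbrs E W v. npaths E W u t)"
    unfolding W(1) by (rule npaths_step) (use assms sv in auto)
  also have "nbrs E W v = {w}" using nv w by (auto simp: W(1) nbrs_Diff)
  finally have 1: "npaths E (V - {s}) v t = npaths E W w t" by simp
  have 2: "npaths E (V - {s}) u t = npaths E W u t" if "u \<noteq> v" for u
    unfolding W(1) by (rule npaths_delete_leaf) (use assms that nv in auto)
  have "npaths E (V - {v}) s t = (\<Sum>u\<in>nbrs E W s. npaths E W u t)"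
    unfolding W(2) by (rule npaths_step) (use assms sv in auto)
  also have "nbrs E W s = nbrs E V s - {v}" using not_own_nbr[OF assms(3), of s V] by (auto simp: W_def nbrs_Diff)
  finally show ?thesis
    using npaths_split_nbr[OF assms(1,3-5) v] 1 2 by (simp add: W_def[symmetric])
qed

text \<open>
  The one path in which \<open>t\<close> follows \<open>s\<close> immediately, and the paths which reach \<open>t\<close> from \<open>w\<close>.
\<close>

lemma npaths_tip_target:
  assumes "finite V" "symp E" "irreflp E" "s \<in> V" "t \<in> V" "nbrs E V t = {s, w}" "E s w"
  shows "npaths E V s t = 1 + npaths E (V - {t}) s w"
proof -
  define W where "W = V - {s, t}"
  have t: "t \<in> nbrs E V s" using nbrs_sym[of E s V t] assms by simp
  have st: "s \<noteq> t" using t not_own_nbr[OF assms(3)] by metis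
  have "w \<in> nbrs E V t" using assms(6) by simp
  then have w: "w \<in> V" "w \<noteq> s" "w \<noteq> t"
    using assms(3,7) by (auto simp: nbrs_def irreflp_def)
  have W: "W = V - {s} - {t}" "W = V - {t} - {s}" by (auto simp: W_def)
  have nt: "nbrs E (V - {s}) t = {w}" using assms(6) w by (auto simp: nbrs_Diff)
  have 2: "npaths E (V - {s}) u t = npaths E W u w" if "u \<noteq> t" for u
    unfolding W(1) by (rule npaths_leaf_target) (use assms that nt st in auto)
  have "npaths E (V - {t}) s w = (\<Sum>u\<in>nbrs E W s. npaths E W u w)"
    unfolding W(2) by (rule npaths_step) (use assms st w in auto)
  also have "nbrs E W s = nbrs E V s - {t}" using not_own_nbr[OF assms(3), of s V] by (auto simp: W_def nbrs_Diff)
  finally show ?thesis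
    using npaths_split_nbr[OF assms(1,3,4) st t] 2 st assms(5) by (simp add: npaths_same)
qed

definition add_edge :: "('v \<Rightarrow> 'v \<Rightarrow> bool) \<Rightarrow> 'v \<Rightarrow> 'v \<Rightarrow> 'v \<Rightarrow> 'v \<Rightarrow> bool" where
  "add_edge E s w x y \<longleftrightarrow> E x y \<or> (x = s \<and> y = w) \<or> (x = w \<and> y = s)"

text \<open>
  Suppressing a vertex \<open>v\<close> of degree two. If \<open>v\<close> is the target, then a path ends by entering \<open>v\<close> either
  from \<open>s\<close> or from \<open>w\<close>, and both kinds become paths to \<open>w\<close> in the contracted graph.
\<close>

lemma npaths_contract:
  assumes "finite V" "symp E" "irreflp E" "s \<in> V" "s \<noteq> t" "v \<in> V" "nbrs E V v = {s, w}"
    "\<not> E s w" "w \<noteq> s"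
  shows "npaths E V s t = npaths (add_edge E s w) (V - {v}) s (if t = v then w else t)"
proof -
  define W t' E' where "W = V - {s, v}" and "t' = (if t = v then w else t)" and "E' = add_edge E s w"
  have v: "v \<in> nbrs E V s" using nbrs_sym[of E s V v] assms by simp
  have sv: "s \<noteq> v" using v not_own_nbr[OF assms(3)] by metis
  have "w \<in> nbrs E V v" using assms(7) by simp
  then have w: "w \<in> V" "w \<noteq> v" using assms(3) by (auto simp: nbrs_def irreflp_def)
  have W: "W = V - {s} - {v}" "W = V - {v} - {s}" by (auto simp: W_def)
  have nv: "nbrs E (V - {s}) v = {w}" using assms(7,9) w by (auto simp: nbrs_Diff)
  have 1: "npaths E (V - {s}) v t = npaths E W w t'"
  proof (cases "t = v")
    case True
    then show ?thesis using assms(6,9) sv w by (simp add: npaths_same t'_def W_def)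
  next
    case False
    have "npaths E (V - {s}) v t = (\<Sum>u\<in>nbrs E W v. npaths E W u t)"
      unfolding W(1) by (rule npaths_step) (use assms sv False in auto)
    also have "nbrs E W v = {w}" using nv w by (auto simp: W(1) nbrs_Diff)
    finally show ?thesis using False by (simp add: t'_def)
  qed
  have 2: "npaths E (V - {s}) u t = npaths E W u t'" if "u \<noteq> v" for u
  proof (cases "t = v")
    case True
    then show ?thesis
      unfolding W(1) t'_def using assms that nv sv by (simp add: npaths_leaf_target[where w = w])
  next
    case False
    then show ?thesis
      unfolding W(1) t'_def using assms that nv by (simp add: npaths_delete_leaf[where w = w])
  qed
  have "npaths E' (V - {v}) s t' = (\<Sum>u\<in>nbrs E' W s. npaths E' W u t')"
    unfolding W(2) by (rule npaths_step) (use assms sv t'_def in auto)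
  also have "\<dots> = (\<Sum>u\<in>nbrs E' W s. npaths E W u t')"
    by (intro sum.cong npaths_cong refl) (auto simp: W_def E'_def add_edge_def)
  also have "nbrs E' W s = insert w (nbrs E V s - {v})"
    using assms(3,9) w by (auto simp: W_def nbrs_def irreflp_def E'_def add_edge_def)
  also have "(\<Sum>u\<in>insert w (nbrs E V s - {v}). npaths E W u t')
      = npaths E W w t' + (\<Sum>u\<in>nbrs E V s - {v}. npaths E W u t')"
    using assms(1,8) by (subst sum.insert) (auto simp: finite_nbrs nbrs_def)
  finally show ?thesis
    using npaths_split_nbr[OF assms(1,3-5) v] 1 2 by (simp add: t'_def E'_def)
qed

section \<open>The degree bound under induction\<close>

definition vdeg :: "('v \<Rightarrow> 'v \<Rightarrow> bool) \<Rightarrow> 'v set \<Rightarrow> 'v \<Rightarrow> nat" where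
  "vdeg E V v = card (nbrs E V v)"

definition degree_bound :: "('v \<Rightarrow> 'v \<Rightarrow> bool) \<Rightarrow> 'v set \<Rightarrow> 'v \<Rightarrow> real" where
  "degree_bound E V s = a_fun (vdeg E V s) * (\<Prod>v\<in>V - {s}. b_fun (vdeg E V v))"

lemma vdeg_mono: "finite V \<Longrightarrow> U \<subseteq> V \<Longrightarrow> vdeg E U x \<le> vdeg E V x"
  unfolding vdeg_def by (intro card_mono finite_nbrs nbrs_mono)

lemma vdeg_remove:
  "finite V \<Longrightarrow> v \<in> nbrs E V x \<Longrightarrow> vdeg E (V - {v}) x = vdeg E V x - 1"
  unfolding vdeg_def nbrs_Diff by (simp add: finite_nbrs)

lemma prod_b_ge_1: "1 \<le> (\<Prod>x\<in>U. b_fun (f x))"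
  by (rule prod_ge_1) (rule b_fun_ge_1)

lemma prod_b_mono:
  assumes "finite W" "U \<subseteq> W" "\<And>x. x \<in> U \<Longrightarrow> f x \<le> g x"
  shows "(\<Prod>x\<in>U. b_fun (f x)) \<le> (\<Prod>x\<in>W. b_fun (g x))"
proof -
  have "(\<Prod>x\<in>U. b_fun (f x)) \<le> (\<Prod>x\<in>U. b_fun (g x))"
    using assms(3) by (intro prod_mono) (auto simp: less_imp_le b_fun_pos b_fun_mono)
  also have "\<dots> \<le> (\<Prod>x\<in>W. b_fun (g x))"
    by (rule prod_mono2) (use assms in \<open>auto simp: b_fun_ge_1 less_imp_le b_fun_pos\<close>)
  finally show ?thesis .
qed

lemma degree_bound_mono:
  assumes "finite V" "U \<subseteq> V" "s \<in> U" "\<And>x. x \<in> U \<Longrightarrow> vdeg F U x \<le> vdeg E V x"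
  shows "degree_bound F U s \<le> degree_bound E V s"
  unfolding degree_bound_def using assms prod_b_ge_1[of "vdeg F U" "U - {s}"]
  by (intro mult_mono prod_b_mono a_mono) (auto simp: less_imp_le a_pos intro: order_trans[OF zero_le_one])

lemma degree_bound_ge_1: "1 \<le> degree_bound E V s"
  unfolding degree_bound_def using mult_mono[OF a_ge_1 prod_b_ge_1] by (simp add: less_imp_le a_pos)

lemma prod_two_removed:
  assumes "finite A" "x \<in> A" "y \<in> A" "x \<noteq> y"
  shows "(\<Prod>z\<in>A. f z) = f x * (f y * (\<Prod>z\<in>A - {x, y}. f z :: real))"
proof -
  have "A - {x} - {y} = A - {x, y}" by auto
  then show ?thesis using assms by (simp add: prod.remove[of A x] prod.remove[of "A - {x}" y])
qed

text \<open>
  One step of the induction on the number of vertices, for distinct end vertices. The induction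
  hypothesis quantifies over the edge relation because of contractions.
\<close>

locale path_induction =
  fixes E :: "'v \<Rightarrow> 'v \<Rightarrow> bool" and V :: "'v set" and s t :: 'v
  assumes fin: "finite V" and sym: "symp E" and irr: "irreflp E"
    and s_in: "s \<in> V" and s_t: "s \<noteq> t"
    and IH: "\<And>(E' :: 'v \<Rightarrow> 'v \<Rightarrow> bool) V' s' t'. card V' < card V \<Longrightarrow> finite V' \<Longrightarrow> symp E' \<Longrightarrow> irreflp E'
      \<Longrightarrow> s' \<in> V' \<Longrightarrow> real (npaths E' V' s' t') \<le> degree_bound E' V' s'"
begin

lemma IH_subset:
  assumes "U \<subset> V" "u \<in> U"
  shows "real (npaths E U u x) \<le> degree_bound E U u"
  using assms fin by (intro IH sym irr psubset_card_mono) (auto intro: finite_subset)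

lemma IH_delete:
  assumes "v \<in> V" "v \<noteq> s"
  shows "real (npaths E (V - {v}) s x) \<le> degree_bound E V s"
proof -
  have "real (npaths E (V - {v}) s x) \<le> degree_bound E (V - {v}) s"
    using assms s_in by (intro IH_subset) auto
  also have "\<dots> \<le> degree_bound E V s" using assms s_in fin by (intro degree_bound_mono vdeg_mono) auto
  finally show ?thesis .
qed

lemma nbr_facts:
  assumes "v \<in> nbrs E V s"
  shows "v \<in> V" "v \<noteq> s" "E s v" "E v s" "s \<in> nbrs E V v"
proof -
  show "v \<in> V" "E s v" using assms by (auto simp: nbrs_def)
  then show "E v s" using sym by (auto dest: sympD)
  then show "s \<in> nbrs E V v" using s_in by (simp add: nbrs_def)
  show "v \<noteq> s" using assms not_own_nbr[OF irr] by metis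
qed

lemma leaf_bound:
  assumes v: "v \<in> nbrs E V s" and d: "vdeg E V v = 1"
  shows "real (npaths E V s t) \<le> degree_bound E V s"
proof -
  note v = v nbr_facts[OF v]
  obtain x where "nbrs E V v = {x}" using d by (auto simp: vdeg_def card_1_singleton_iff)
  then have nv: "nbrs E V v = {s}" using v by auto
  show ?thesis
  proof (cases "v = t")
    case True
    then have "npaths E V s t = npaths E (V - {t}) s s"
      using nv v by (intro npaths_leaf_target fin sym irr s_t) auto
    then show ?thesis using s_in s_t degree_bound_ge_1[of E V s] by (simp add: npaths_same)
  next
    case False
    then have "npaths E V s t = npaths E (V - {v}) s t"
      using nv v by (intro npaths_delete_leaf[where w = s] fin sym) auto
    then show ?thesis using IH_delete v by simp
  qed
qed

text \<open>
  No degree increases under the contraction: the new edge replaces an edge to the suppressed vertex at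
  both of its ends.
\<close>

lemma contract_bound:
  assumes v: "v \<in> nbrs E V s" and nv: "nbrs E V v = {s, w}" and w: "w \<noteq> s" "\<not> E s w"
  shows "real (npaths E V s t) \<le> degree_bound E V s"
proof -
  note v = v nbr_facts[OF v]
  define E' U where "E' = add_edge E s w" and "U = V - {v}"
  have "w \<in> nbrs E V v" using nv by simp
  then have w': "w \<in> V" "E v w" "E w v" "w \<noteq> v"
    using sym irr by (auto simp: nbrs_def irreflp_def dest: sympD)
  have E': "symp E'" "irreflp E'"
    using sym irr w by (auto simp: E'_def add_edge_def symp_def irreflp_def)
  have "npaths E V s t = npaths E' U s (if t = v then w else t)"
    unfolding E'_def U_def
    by (rule npaths_contract) (use fin sym irr s_in s_t v nv w in auto)
  also have "real \<dots> \<le> degree_bound E' U s"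
    unfolding U_def using fin v s_in E' by (intro IH card_Diff1_less) auto
  also have "\<dots> \<le> degree_bound E V s"
  proof (rule degree_bound_mono)
    fix x assume x: "x \<in> U"
    define y where "y = (if x = s then w else s)"
    show "vdeg E' U x \<le> vdeg E V x"
    proof (cases "x = s \<or> x = w")
      case True
      have vx: "v \<in> nbrs E V x" using True v w' by (auto simp: nbrs_def)
      have "nbrs E' U x \<subseteq> insert y (nbrs E V x - {v})"
        using True by (auto simp: U_def E'_def add_edge_def nbrs_def y_def)
      then have "vdeg E' U x \<le> card (insert y (nbrs E V x - {v}))"
        unfolding vdeg_def using fin by (intro card_mono) (auto simp: finite_nbrs)
      also have "\<dots> \<le> Suc (card (nbrs E V x - {v}))" by (rule card_insert_le_m1) auto
      also have "\<dots> = vdeg E V x"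
        unfolding vdeg_def by (rule card_Suc_Diff1) (use fin vx in \<open>auto simp: finite_nbrs\<close>)
      finally show ?thesis .
    next
      case False
      then have "nbrs E' U x \<subseteq> nbrs E V x"
        by (auto simp: U_def E'_def add_edge_def nbrs_def)
      then show ?thesis unfolding vdeg_def using fin by (intro card_mono finite_nbrs)
    qed
  qed (use fin s_in v in \<open>auto simp: U_def\<close>)
  finally show ?thesis .
qed

text \<open>
  For \<open>t = w\<close> the two paths are \<open>s w\<close> and \<open>s v w\<close>, and \<open>a(2) b(2)\<^sup>2 = 2\<close> makes the bound exact on a triangle.
  Otherwise the triangle contributes no path and \<open>v\<close> can be deleted.
\<close>

lemma pendant_triangle_bound_aux:
  assumes v: "v \<in> V" and nv: "nbrs E V v = {s, w}" and nw: "nbrs E V w = {s, v}"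
    and t: "t \<noteq> v"
  shows "real (npaths E V s t) \<le> degree_bound E V s"
proof -
  have "s \<in> nbrs E V v" "w \<in> nbrs E V v" "s \<in> nbrs E V w" using nv nw by auto
  then have E: "E s v" "E s w" "w \<in> V" "v \<noteq> s" "w \<noteq> s" "v \<noteq> w"
    using sym irr by (auto simp: nbrs_def irreflp_def dest: sympD)
  have split: "npaths E V s t = npaths E (V - {v}) s t + npaths E (V - {s, v}) w t"
    by (rule npaths_tip) (use fin sym irr s_in s_t v nv E t in auto)
  have nw': "nbrs E (V - {s, v}) w = {}" using nw by (auto simp: nbrs_Diff)
  show ?thesis
  proof (cases "t = w")
    case True
    have "npaths E (V - {v}) s t = npaths E (V - {v} - {t}) s s"
      using fin sym irr s_t E nw
      by (intro npaths_leaf_target) (auto simp: True nbrs_Diff)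
    then have "npaths E V s t = 2"
      using split s_in E True by (simp add: npaths_same)
    moreover have "2 \<le> degree_bound E V s"
    proof -
      have "nbrs E V s \<supseteq> {v, w}" using E v by (auto simp: nbrs_def)
      then have "card {v, w} \<le> vdeg E V s"
        unfolding vdeg_def using fin by (intro card_mono finite_nbrs)
      then have "a_fun 2 \<le> a_fun (vdeg E V s)" using E by (intro a_mono) simp
      moreover have "(\<Prod>x\<in>{v, w}. b_fun (vdeg E V x)) \<le> (\<Prod>x\<in>V - {s}. b_fun (vdeg E V x))"
        by (rule prod_b_mono) (use fin v E in auto)
      moreover have "(\<Prod>x\<in>{v, w}. b_fun (vdeg E V x)) = rho * rho"
        using E nv nw by (simp add: vdeg_def b_fun_2 numeral_2_eq_2[symmetric])
      ultimately have "a_fun 2 * (rho * rho) \<le> degree_bound E V s"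
        unfolding degree_bound_def using a_pos rho_pos by (intro mult_mono) (auto simp: less_imp_le)
      then show ?thesis using rho_pos by (simp add: a_2 power2_eq_square)
    qed
    ultimately show ?thesis by simp
  next
    case False
    then have "npaths E (V - {s, v}) w t = 0"
      using nw' fin by (intro npaths_no_nbrs) auto
    then show ?thesis using split IH_delete[OF v] E by simp
  qed
qed

lemma pendant_triangle_bound:
  assumes "v \<in> V" "nbrs E V v = {s, w}" "nbrs E V w = {s, v}"
  shows "real (npaths E V s t) \<le> degree_bound E V s"
proof (cases "t = v")
  case True
  have "w \<in> nbrs E V v" using assms by simp
  then have "w \<in> V" "t \<noteq> w" using True irr by (auto simp: nbrs_def irreflp_def)
  then show ?thesis using assms by (intro pendant_triangle_bound_aux[of w v])
next
  case False
  then show ?thesis using assms by (intro pendant_triangle_bound_aux[of v w])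
qed

lemma tip_target_bound:
  assumes t: "t \<in> V" and nt: "nbrs E V t = {s, w}" and w: "E s w" "vdeg E V w \<ge> 3"
    and deg2: "\<And>u. u \<in> nbrs E V s \<Longrightarrow> vdeg E V u \<ge> 2"
  shows "real (npaths E V s t) \<le> degree_bound E V s"
proof -
  define k d R where "k = vdeg E V s" and "d = vdeg E V w" and "R = V - {s, t, w}"
  define P where "P = (\<Prod>x\<in>R. b_fun (vdeg E V x))"
  have "s \<in> nbrs E V t" "w \<in> nbrs E V t" using nt by auto
  then have E: "E s t" "E w t" "w \<in> V" "t \<noteq> s" "w \<noteq> s" "t \<noteq> w"
    using sym irr w(1) by (auto simp: nbrs_def irreflp_def dest: sympD)
  have tn: "t \<in> nbrs E V s" "w \<in> nbrs E V s" "t \<in> nbrs E V w" using E t w by (auto simp: nbrs_def)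
  have dt: "vdeg E V t = 2" using nt E by (simp add: vdeg_def)
  have P: "1 \<le> P" unfolding P_def by (rule prod_b_ge_1)
  have R: "R = V - {s} - {t, w}" "R = V - {t} - {s} - {w}" by (auto simp: R_def)
  have q: "degree_bound E V s = a_fun k * b_fun d * rho * P"
    using prod_two_removed[of "V - {s}" t w "\<lambda>x. b_fun (vdeg E V x)"] fin t E
    unfolding degree_bound_def by (simp add: R P_def k_def d_def dt b_fun_2)
  have "npaths E V s t = 1 + npaths E (V - {t}) s w"
    by (rule npaths_tip_target) (use fin sym irr s_in t nt w in auto)
  moreover have "real (npaths E (V - {t}) s w) \<le> degree_bound E (V - {t}) s"
    using t s_in E by (intro IH_subset) auto
  moreover have "degree_bound E (V - {t}) s \<le> a_fun (k - 1) * (b_fun (d - 1) * P)"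
  proof -
    have "(\<Prod>x\<in>V - {t} - {s}. b_fun (vdeg E (V - {t}) x))
        = b_fun (vdeg E (V - {t}) w) * (\<Prod>x\<in>R. b_fun (vdeg E (V - {t}) x))"
      unfolding R(2) using fin E by (intro prod.remove) auto
    also have "\<dots> \<le> b_fun (d - 1) * P"
      unfolding P_def using fin tn b_fun_pos[of "d - 1"] vdeg_mono[OF fin, of "V - {t}" E]
      by (intro mult_mono prod_b_mono) (auto simp: vdeg_remove d_def R_def prod_nonneg less_imp_le b_fun_pos)
    finally show ?thesis
      unfolding degree_bound_def using fin tn a_pos[of "k - 1"] by (simp add: vdeg_remove k_def)
  qed
  ultimately have n: "real (npaths E V s t) \<le> 1 + a_fun (k - 1) * b_fun (d - 1) * P"
    by (simp add: mult.assoc)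
  have d3: "d \<ge> 3" using w by (simp add: d_def)
  have "1 \<le> P * (a_fun k * b_fun d * rho - a_fun (k - 1) * b_fun (d - 1))"
  proof (cases "nbrs E V s = {t, w}")
    case True
    then have "k = 2" using E by (simp add: k_def vdeg_def)
    then have "1 \<le> a_fun k * b_fun d * rho - a_fun (k - 1) * b_fun (d - 1)"
      using tip_target_gap(1)[OF d3] by simp
    from mult_mono[OF P this] show ?thesis using P by simp
  next
    case False
    then obtain x where x: "x \<in> nbrs E V s" "x \<noteq> t" "x \<noteq> w" using tn by auto
    have "card {t, w, x} \<le> k"
      unfolding k_def vdeg_def using fin tn x by (intro card_mono finite_nbrs) auto
    then have "k \<ge> 3" using E x by simp
    note gap = tip_target_gap(2)[OF d3 this]
    have "b_fun 2 \<le> b_fun (vdeg E V x)" by (rule b_fun_mono[OF deg2[OF x(1)]])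
    also have "\<dots> = (\<Prod>y\<in>{x}. b_fun (vdeg E V y))" by simp
    also have "\<dots> \<le> P"
      unfolding P_def using fin x nbr_facts[OF x(1)] by (intro prod_b_mono) (auto simp: R_def)
    finally have "rho \<le> P" by (simp add: b_fun_2)
    moreover have "0 < rho * (a_fun k * b_fun d * rho - a_fun (k - 1) * b_fun (d - 1))"
      using gap by linarith
    then have "0 < a_fun k * b_fun d * rho - a_fun (k - 1) * b_fun (d - 1)"
      using rho_pos by (simp only: zero_less_mult_pos)
    ultimately show ?thesis
      using order_trans[OF gap mult_right_mono[of rho P]] by simp
  qed
  then have "1 + a_fun (k - 1) * b_fun (d - 1) * P \<le> degree_bound E V s"
    unfolding q by (simp add: algebra_simps)
  with n show ?thesis by linarith
qed

text \<open>
  The general situation, after leaves and suppressible vertices are excluded: the neighbours of \<open>s\<close> are bases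
  and tips. Either a tip is removed, or the neighbourhood inequality is applied with all tips deleted at once.
\<close>

lemma tips_bound:
  assumes t: "t \<in> V" and ne: "nbrs E V s \<noteq> {}"
    and deg2: "\<And>v. v \<in> nbrs E V s \<Longrightarrow> vdeg E V v \<ge> 2"
    and tips: "\<And>v. v \<in> nbrs E V s \<Longrightarrow> vdeg E V v = 2 \<Longrightarrow>
      v \<noteq> t \<and> (\<exists>w. nbrs E V v = {s, w} \<and> E s w \<and> vdeg E V w \<ge> 3)"
  shows "real (npaths E V s t) \<le> degree_bound E V s"
proof -
  define N k where "N = nbrs E V s" and "k = vdeg E V s"
  \<comment> \<open>\<open>T\<close> are the tips and \<open>B\<close> the bases, including neighbours without tips.\<close>
  define T where "T = {v \<in> N. vdeg E V v = 2}"
  define B H where "B = N - T" and "H = V - {s} - T"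
  have "\<forall>v\<in>T. \<exists>w. nbrs E V v = {s, w} \<and> E s w \<and> vdeg E V w \<ge> 3"
    using tips by (auto simp: T_def N_def)
  then obtain f where f: "\<And>v. v \<in> T \<Longrightarrow> nbrs E V v = {s, f v}"
      "\<And>v. v \<in> T \<Longrightarrow> E s (f v)" "\<And>v. v \<in> T \<Longrightarrow> vdeg E V (f v) \<ge> 3"
    by (auto dest!: bchoice)
  have tT: "t \<notin> T" using tips by (auto simp: T_def N_def)
  have fN: "finite N" "finite T" "finite B" "finite H" "finite V"
    using fin by (auto simp: N_def T_def B_def H_def finite_nbrs)
  have TN: "T \<subseteq> N" "T \<subseteq> V" "s \<notin> T" "s \<notin> N" "N \<subseteq> V"
    using nbr_facts by (auto simp: T_def N_def)
  have f_nbr: "f v \<in> nbrs E V v" if "v \<in> T" for v using f(1)[OF that] by simp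
  have f_B: "f v \<in> B" "f v \<noteq> v" if "v \<in> T" for v
  proof -
    have "f v \<in> V" "E v (f v)" using f_nbr[OF that] by (auto simp: nbrs_def)
    then show "f v \<in> B" using f(2,3)[OF that] by (auto simp: B_def N_def T_def nbrs_def)
    show "f v \<noteq> v" using \<open>E v (f v)\<close> irr by (auto simp: irreflp_def)
  qed
  define c m where "c u = card {v \<in> T. f v = u}" and "m u = vdeg E H u" for u
  have tip_iff: "E u v \<longleftrightarrow> f v = u" if "v \<in> T" "u \<in> B" for u v
  proof
    assume "E u v"
    then have "u \<in> nbrs E V v"
      using that TN sym by (auto simp: B_def N_def nbrs_def dest: sympD)
    then show "f v = u" using f(1)[OF that(1)] that TN by (auto simp: B_def)
  next
    assume "f v = u"
    then show "E u v" using f_nbr[OF that(1)] sym by (auto simp: nbrs_def dest: sympD)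
  qed
  have deg_B: "vdeg E V u = m u + 1 + c u" if u: "u \<in> B" for u
  proof -
    have us: "s \<in> nbrs E V u" using u nbr_facts(5)[of u] by (auto simp: B_def N_def)
    have "nbrs E V u = insert s (nbrs E H u \<union> {v \<in> T. f v = u})"
      using us tip_iff[OF _ u] TN by (auto simp: H_def nbrs_def)
    also have "card \<dots> = Suc (card (nbrs E H u \<union> {v \<in> T. f v = u}))"
      using fN TN by (intro card_insert_disjoint) (auto simp: H_def nbrs_def)
    also have "card (nbrs E H u \<union> {v \<in> T. f v = u}) = m u + c u"
      unfolding m_def c_def vdeg_def
      using fN by (intro card_Un_disjoint) (auto simp: H_def nbrs_def)
    finally show ?thesis by (simp add: vdeg_def)
  qed
  have regroup: "(\<Sum>v\<in>T. g (f v)) = (\<Sum>u\<in>B. c u * g u)" for g :: "'v \<Rightarrow> nat"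
  proof -
    have "(\<Sum>v\<in>T. g (f v)) = (\<Sum>u\<in>B. \<Sum>v\<in>{v \<in> T. f v = u}. g (f v))"
      using fN f_B by (intro sum.group[symmetric]) auto
    also have "\<dots> = (\<Sum>u\<in>B. \<Sum>v\<in>{v \<in> T. f v = u}. g u)"
      by (intro sum.cong) auto
    finally show ?thesis by (simp add: c_def)
  qed
  have card_T: "card T = (\<Sum>u\<in>B. c u)" using regroup[of "\<lambda>_. 1"] by simp
  have N_split: "N = B \<union> T" "B \<inter> T = {}" using TN by (auto simp: B_def)
  have "k = card (B \<union> T)" unfolding N_split(1)[symmetric] k_def vdeg_def N_def ..
  also have "\<dots> = card B + card T" using fN N_split(2) by (intro card_Un_disjoint) auto
  finally have k_sum: "k = (\<Sum>u\<in>B. Suc (c u))" by (simp add: card_T sum_Suc)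
  have leaf: "nbrs E (V - {s} - X) v \<subseteq> {f v}" if "v \<in> T" for v X
    using f(1)[OF that] by (auto simp: nbrs_Diff)
  have paths_B: "npaths E (V - {s}) u t = npaths E H u t" if "u \<notin> T" for u
    unfolding H_def using leaf[of _ "{}"] fN tT that sym
    by (intro npaths_delete_leaves[where f = f]) auto
  have paths_T: "npaths E (V - {s}) v t = npaths E H (f v) t" if v: "v \<in> T" for v
  proof -
    have "npaths E (V - {s}) v t = (\<Sum>u\<in>nbrs E (V - {s} - {v}) v. npaths E (V - {s} - {v}) u t)"
      using fN v TN tT by (intro npaths_step) auto
    also have "nbrs E (V - {s} - {v}) v = {f v}"
      using f(1)[OF v] f_B[OF v] TN by (auto simp: nbrs_Diff B_def)
    also have "(\<Sum>u\<in>{f v}. npaths E (V - {s} - {v}) u t) = npaths E (V - {s} - {v}) (f v) t"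
      by simp
    also have "\<dots> = npaths E (V - {s} - {v} - (T - {v})) (f v) t"
      using fN leaf[of _ "{v}"] tT f_B[OF v] sym N_split(2)
      by (intro npaths_delete_leaves[where f = f]) auto
    also have "V - {s} - {v} - (T - {v}) = H" using v by (auto simp: H_def)
    finally show ?thesis .
  qed
  have H_sub: "H \<subset> V" "B \<subseteq> H" using s_in TN by (auto simp: H_def B_def)
  have rest: "vdeg E H x \<le> vdeg E V x" for x using H_sub fin by (intro vdeg_mono) auto
  show ?thesis
  proof (cases "\<exists>u\<in>B. c u \<ge> 1 \<and> tip_removable k (m u) (c u)")
    case True
    then obtain u where u: "u \<in> B" "c u \<ge> 1" "tip_removable k (m u) (c u)" by auto
    then have "{v \<in> T. f v = u} \<noteq> {}" unfolding c_def by (metis card.empty not_one_le_zero)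
    then obtain v where v: "v \<in> T" "f v = u" by auto
    define R where "R = V - {s} - {v, u}"
    define P where "P = (\<Prod>x\<in>R. b_fun (vdeg E V x))"
    have P: "P \<ge> 1" unfolding P_def by (rule prod_b_ge_1)
    have vV: "v \<in> V" "v \<noteq> s" "u \<in> V" "u \<noteq> s" "v \<noteq> u" "E v u"
      using v u TN f_B[OF v(1)] f_nbr[OF v(1)] by (auto simp: B_def nbrs_def)
    have dv: "vdeg E V v = 2" using v by (simp add: T_def)
    have q: "degree_bound E V s = a_fun k * (rho * (b_fun (m u + 1 + c u) * P))"
      using prod_two_removed[of "V - {s}" v u "\<lambda>x. b_fun (vdeg E V x)"] fin vV deg_B[OF u(1)]
      unfolding degree_bound_def by (simp add: R_def P_def k_def dv b_fun_2)
    have "npaths E V s t = npaths E (V - {v}) s t + npaths E (V - {s, v}) u t"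
      by (rule npaths_tip) (use fin sym irr s_in s_t vV v f tT in auto)
    also have "V - {s, v} = V - {s} - {v}" by auto
    also have "npaths E (V - {s} - {v}) u t = npaths E (V - {s} - {v} - (T - {v})) u t"
      using fN leaf[of _ "{v}"] tT u(1) sym N_split(2)
      by (intro npaths_delete_leaves[where f = f]) auto
    also have "V - {s} - {v} - (T - {v}) = H" using v by (auto simp: H_def)
    finally have n: "real (npaths E V s t) = real (npaths E (V - {v}) s t) + real (npaths E H u t)"
      by simp
    have "real (npaths E (V - {v}) s t) \<le> degree_bound E (V - {v}) s"
      using vV s_in by (intro IH_subset) auto
    also have "\<dots> \<le> a_fun (k - 1) * (b_fun (m u + c u) * P)"
    proof -
      have "v \<in> nbrs E V s" "v \<in> nbrs E V u"
        using v TN vV sym by (auto simp: N_def nbrs_def dest: sympD)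
      note g = vdeg_remove[OF fin this(1)] vdeg_remove[OF fin this(2)]
      have "(\<Prod>x\<in>V - {v} - {s}. b_fun (vdeg E (V - {v}) x))
          = b_fun (vdeg E (V - {v}) u) * (\<Prod>x\<in>R. b_fun (vdeg E (V - {v}) x))"
      proof -
        have "R = V - {v} - {s} - {u}" by (auto simp: R_def)
        then show ?thesis using fin vV by (simp only:) (intro prod.remove; auto)
      qed
      also have "\<dots> \<le> b_fun (m u + c u) * P"
        unfolding P_def g(2) deg_B[OF u(1)] using fin
        by (intro mult_mono prod_b_mono vdeg_mono)
           (auto simp: R_def prod_nonneg less_imp_le b_fun_pos)
      finally show ?thesis
        unfolding degree_bound_def g(1) using a_pos[of "k - 1"] by (simp add: k_def)
    qed
    finally have 1: "real (npaths E (V - {v}) s t) \<le> a_fun (k - 1) * (b_fun (m u + c u) * P)" .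
    have "real (npaths E H u t) \<le> degree_bound E H u"
      using H_sub u by (intro IH_subset) auto
    also have "\<dots> \<le> a_fun (m u) * (P / rho ^ (c u - 1))"
    proof -
      have "card ({v \<in> T. f v = u} - {v}) \<le> card (T - {v})"
        using fN by (intro card_mono) auto
      then have cT: "c u - 1 \<le> card (T - {v})" using v fN by (simp add: c_def)
      have "R = (H - {u}) \<union> (T - {v})" "(H - {u}) \<inter> (T - {v}) = {}"
        using TN v u by (auto simp: R_def H_def B_def)
      then have "P = (\<Prod>x\<in>H - {u}. b_fun (vdeg E V x)) * (\<Prod>x\<in>T - {v}. b_fun (vdeg E V x))"
        unfolding P_def using fN by (simp add: prod.union_disjoint)
      also have "(\<Prod>x\<in>T - {v}. b_fun (vdeg E V x)) = rho ^ card (T - {v})"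
        by (simp add: T_def b_fun_2)
      finally have Pe: "P = (\<Prod>x\<in>H - {u}. b_fun (vdeg E V x)) * rho ^ card (T - {v})" .
      have "(\<Prod>x\<in>H - {u}. b_fun (vdeg E H x)) * rho ^ (c u - 1) \<le> P"
        unfolding Pe using fN rest cT rho_gt_1
        by (intro mult_mono prod_b_mono power_increasing)
           (auto simp: prod_nonneg less_imp_le b_fun_pos)
      then have "(\<Prod>x\<in>H - {u}. b_fun (vdeg E H x)) \<le> P / rho ^ (c u - 1)"
        using rho_pos by (simp add: pos_le_divide_eq)
      then show ?thesis
        unfolding degree_bound_def m_def by (rule mult_left_mono) (simp add: a_pos less_imp_le)
    qed
    finally have 2: "real (npaths E H u t) \<le> a_fun (m u) * (P / rho ^ (c u - 1))" .
    have "real (npaths E V s t)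
        \<le> P * (a_fun (k - 1) * b_fun (m u + c u) + a_fun (m u) / rho ^ (c u - 1))"
      unfolding n using 1 2 by (simp add: algebra_simps)
    also have "\<dots> \<le> P * (a_fun k * b_fun (m u + 1 + c u) * rho)"
      using u(3) P by (intro mult_left_mono) (auto simp: tip_removable_def)
    also have "\<dots> = degree_bound E V s" unfolding q by (simp only: mult_ac)
    finally show ?thesis .
  next
    case False
    define P where "P = (\<Prod>x\<in>H - B. b_fun (vdeg E V x))"
    define PB where "PB = (\<Prod>u\<in>B. b_fun (m u))"
    have Bne: "B \<noteq> {}" using ne f_B by (auto simp: N_def[symmetric] B_def)
    have big: "vdeg E V u \<ge> 3" if "u \<in> B" for u
      using deg2[of u] that by (auto simp: B_def T_def N_def le_less)
    have ineq: "(\<Sum>u\<in>B. real (Suc (c u)) * alpha_fun (m u)) * PB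
        \<le> a_fun k * (\<Prod>u\<in>B. b_fun (m u + 1 + c u)) * rho ^ (\<Sum>u\<in>B. c u)"
      unfolding PB_def
    proof (rule neighbourhood_inequality)
      show "m u \<ge> 2" if "u \<in> B" "c u = 0" for u using big[OF that(1)] deg_B[OF that(1)] that by simp
      show "m u \<ge> 1" if "u \<in> B" "c u = 1" for u using big[OF that(1)] deg_B[OF that(1)] that by simp
    qed (use fN Bne k_sum False in auto)
    have paths_H: "real (npaths E H u t) \<le> alpha_fun (m u) * (PB * P)" if u: "u \<in> B" for u
    proof -
      have "real (npaths E H u t) \<le> degree_bound E H u"
        using H_sub u by (intro IH_subset) auto
      also have "\<dots> = alpha_fun (m u) * (\<Prod>x\<in>H. b_fun (vdeg E H x))"
        using prod.remove[of H u "\<lambda>x. b_fun (vdeg E H x)"] fN H_sub u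
        by (auto simp: degree_bound_def a_fun_def m_def)
      also have "(\<Prod>x\<in>H. b_fun (vdeg E H x)) = (\<Prod>x\<in>H - B. b_fun (vdeg E H x)) * PB"
        unfolding PB_def m_def using fN H_sub by (intro prod.subset_diff) auto
      also have "(\<Prod>x\<in>H - B. b_fun (vdeg E H x)) \<le> P"
        unfolding P_def using fN rest by (intro prod_b_mono) auto
      finally show ?thesis
        using alpha_pos[of "m u"] prod_b_ge_1[of m B] by (simp add: PB_def mult_ac)
    qed
    have "nbrs E (V - {s}) s = N" using TN by (simp add: nbrs_Diff N_def)
    then have "npaths E V s t = (\<Sum>u\<in>N. npaths E (V - {s}) u t)"
      using npaths_step[OF fin s_in s_t, of E] by simp
    also have "\<dots> = (\<Sum>u\<in>B. npaths E (V - {s}) u t) + (\<Sum>v\<in>T. npaths E (V - {s}) v t)"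
      unfolding N_split(1) using fN N_split(2) by (intro sum.union_disjoint) auto
    also have "(\<Sum>u\<in>B. npaths E (V - {s}) u t) = (\<Sum>u\<in>B. npaths E H u t)"
      by (intro sum.cong paths_B) (auto simp: B_def)
    also have "(\<Sum>v\<in>T. npaths E (V - {s}) v t) = (\<Sum>v\<in>T. npaths E H (f v) t)"
      by (intro sum.cong paths_T) auto
    also have "(\<Sum>u\<in>B. npaths E H u t) + (\<Sum>v\<in>T. npaths E H (f v) t)
        = (\<Sum>u\<in>B. Suc (c u) * npaths E H u t)"
      using regroup[of "\<lambda>u. npaths E H u t"] by (simp add: sum.distrib)
    finally have "real (npaths E V s t) = (\<Sum>u\<in>B. real (Suc (c u)) * real (npaths E H u t))"
      by (simp only: of_nat_sum of_nat_mult)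
    also have "\<dots> \<le> (\<Sum>u\<in>B. real (Suc (c u)) * (alpha_fun (m u) * (PB * P)))"
      by (intro sum_mono mult_left_mono paths_H) auto
    also have "\<dots> = (\<Sum>u\<in>B. real (Suc (c u)) * alpha_fun (m u)) * PB * P"
      by (simp add: sum_distrib_right mult.assoc)
    also have "\<dots> \<le> a_fun k * (\<Prod>u\<in>B. b_fun (m u + 1 + c u)) * rho ^ (\<Sum>u\<in>B. c u) * P"
      using ineq prod_b_ge_1[of "vdeg E V" "H - B"] by (intro mult_right_mono) (auto simp: P_def)
    also have "\<dots> = degree_bound E V s"
    proof -
      have e: "V - {s} = T \<union> H" "T \<inter> H = {}"
        using TN by (auto simp: H_def)
      have "(\<Prod>x\<in>V - {s}. b_fun (vdeg E V x))
          = (\<Prod>x\<in>T. b_fun (vdeg E V x)) * (\<Prod>x\<in>H. b_fun (vdeg E V x))"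
        unfolding e(1) using fN e(2) by (intro prod.union_disjoint) auto
      also have "(\<Prod>x\<in>H. b_fun (vdeg E V x)) = P * (\<Prod>x\<in>B. b_fun (vdeg E V x))"
        unfolding P_def using fN H_sub by (intro prod.subset_diff) auto
      also have "(\<Prod>x\<in>T. b_fun (vdeg E V x)) = rho ^ card T" by (simp add: T_def b_fun_2)
      also have "(\<Prod>x\<in>B. b_fun (vdeg E V x)) = (\<Prod>u\<in>B. b_fun (m u + 1 + c u))"
        by (simp add: deg_B)
      finally show ?thesis by (simp add: degree_bound_def k_def card_T mult_ac)
    qed
    finally show ?thesis .
  qed
qed

text \<open>
  The cases are exhaustive because a neighbour of degree two that cannot be suppressed forms a triangle with
  \<open>s\<close>, whose third vertex has degree two or at least three.
\<close>

lemma bound_step: "real (npaths E V s t) \<le> degree_bound E V s"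
proof -
  define N where "N = nbrs E V s"
  have pair: "\<exists>w. nbrs E V v = {s, w} \<and> w \<noteq> s \<and> w \<in> V \<and> E v w" if v: "v \<in> N" "vdeg E V v = 2" for v
  proof -
    have "\<exists>x y. nbrs E V v = {x, y} \<and> x \<noteq> y"
      using v(2) by (simp only: vdeg_def card_2_iff)
    then obtain x y where "nbrs E V v = {x, y}" "x \<noteq> y" by (elim exE conjE)
    moreover have "s \<in> nbrs E V v" using v nbr_facts(5)[of v] by (simp add: N_def)
    ultimately obtain w where w: "nbrs E V v = {s, w}" "w \<noteq> s" by auto
    then have "w \<in> nbrs E V v" by simp
    then have "w \<in> V" "E v w" by (auto simp: nbrs_def)
    with w show ?thesis by auto
  qed
  consider "t \<notin> V" | "t \<in> V" "N = {}" | v where "v \<in> N" "vdeg E V v = 1"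
    | v w where "v \<in> N" "nbrs E V v = {s, w}" "w \<noteq> s" "\<not> E s w"
    | v w where "v \<in> N" "nbrs E V v = {s, w}" "nbrs E V w = {s, v}"
    | w where "t \<in> N" "nbrs E V t = {s, w}" "E s w" "vdeg E V w \<ge> 3" "\<forall>v\<in>N. vdeg E V v \<ge> 2"
    | "t \<in> V" "N \<noteq> {}" "\<forall>v\<in>N. vdeg E V v \<ge> 2"
      "\<forall>v\<in>N. vdeg E V v = 2 \<longrightarrow> v \<noteq> t \<and> (\<exists>w. nbrs E V v = {s, w} \<and> E s w \<and> vdeg E V w \<ge> 3)"
  proof -
    have deg1: "vdeg E V v \<ge> 1" if "v \<in> N" for v
    proof -
      have "nbrs E V v \<noteq> {}" using nbr_facts(5)[of v] that by (auto simp: N_def)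
      then have "0 < vdeg E V v" using fin by (simp add: vdeg_def finite_nbrs card_gt_0_iff)
      then show ?thesis by simp
    qed
    have both: "vdeg E V w \<ge> 3 \<or> nbrs E V w = {s, v}"
      if v: "v \<in> N" "nbrs E V v = {s, w}" "w \<noteq> s" "E s w" for v w
    proof (rule disjCI)
      assume n: "nbrs E V w \<noteq> {s, v}"
      have "w \<in> nbrs E V v" using v by simp
      then have w: "w \<in> V" "E v w" by (auto simp: nbrs_def)
      then have sub: "{s, v} \<subseteq> nbrs E V w"
        using v sym s_in nbr_facts(1)[of v] by (auto simp: nbrs_def N_def dest: sympD)
      then have "card {s, v} < card (nbrs E V w)"
        using n fin by (intro psubset_card_mono finite_nbrs) auto
      then show "vdeg E V w \<ge> 3"
        using nbr_facts(2)[of v] v by (auto simp: vdeg_def N_def)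
    qed
    have ge2: "vdeg E V v \<ge> 2" if "v \<in> N" "vdeg E V v \<noteq> 1" for v using deg1[OF that(1)] that by linarith
    show thesis
    proof (cases "t \<in> V \<and> N \<noteq> {} \<and> (\<forall>v\<in>N. vdeg E V v \<noteq> 1)
        \<and> \<not> (\<exists>v\<in>N. \<exists>w. nbrs E V v = {s, w} \<and> w \<noteq> s \<and> \<not> E s w)
        \<and> \<not> (\<exists>v\<in>N. \<exists>w. nbrs E V v = {s, w} \<and> nbrs E V w = {s, v})")
      case False
      then show thesis using that(1-5) by blast
    next
      case True
      have tip: "\<exists>w. nbrs E V v = {s, w} \<and> E s w \<and> vdeg E V w \<ge> 3" if "v \<in> N" "vdeg E V v = 2" for v
        using pair[OF that] True both[OF that(1)] that by blast
      have all2: "\<forall>v\<in>N. vdeg E V v \<ge> 2" using True ge2 by simp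
      show thesis
      proof (cases "t \<in> N \<and> vdeg E V t = 2")
        case t: True
        then obtain w where "nbrs E V t = {s, w}" "E s w" "vdeg E V w \<ge> 3"
          using tip[of t] by (elim conjE) auto
        then show thesis using t all2 by (intro that(6)[of w]) auto
      next
        case False
        then have "\<forall>v\<in>N. vdeg E V v = 2 \<longrightarrow>
            v \<noteq> t \<and> (\<exists>w. nbrs E V v = {s, w} \<and> E s w \<and> vdeg E V w \<ge> 3)"
          by (intro ballI impI conjI tip notI) auto
        then show thesis using True all2 by (intro that(7)) simp_all
      qed
    qed
  qed
  then show ?thesis
  proof cases
    case 1
    then show ?thesis using degree_bound_ge_1[of E V s] by (simp add: npaths_outside)
  next
    case 2
    then show ?thesis using degree_bound_ge_1[of E V s] fin s_t by (simp add: npaths_no_nbrs N_def)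
  next
    case 3
    then show ?thesis using leaf_bound by (simp add: N_def)
  next
    case 4
    then show ?thesis using contract_bound by (simp add: N_def)
  next
    case 5
    then show ?thesis
      by (intro pendant_triangle_bound[of v w] nbr_facts(1)) (simp_all add: N_def)
  next
    case 6
    then show ?thesis
      by (intro tip_target_bound[of w] nbr_facts(1)) (simp_all add: N_def)
  next
    case 7
    then show ?thesis by (intro tips_bound) (simp_all add: N_def)
  qed
qed

end

section \<open>The bound for all finite simple graphs\<close>

theorem npaths_le_degree_bound:
  assumes "finite V" "symp E" "irreflp E" "s \<in> V"
  shows "real (npaths E V s t) \<le> degree_bound E V s"
  using assms
proof (induction "card V" arbitrary: E V s t rule: less_induct)
  case less
  show ?case
  proof (cases "s = t")
    case True
    then show ?thesis using less.prems degree_bound_ge_1[of E V s] by (simp add: npaths_same)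
  next
    case False
    interpret path_induction E V s t
      by unfold_locales (use less False in auto)
    show ?thesis by (rule bound_step)
  qed
qed

text \<open>
  Translation between the walks of the graph library and lists with a relation between successive entries.
\<close>

lemma set_vwalk_arcs_iff_successively:
  "set (vwalk_arcs p) \<subseteq> A \<longleftrightarrow> successively (\<lambda>u v. (u, v) \<in> A) p"
  by (induction p rule: vwalk_arcs.induct) auto

theorem theorem7:
  fixes G :: "'v pair_pre_digraph" and s t :: 'v
  assumes "pair_graph G"
    and "s \<in> pverts G" and "t \<in> pverts G"
  shows "real (path_count G s t) \<le> q_bound G s"
proof -
  interpret pair_graph G by fact
  define E where "E = (\<lambda>u v. (u, v) \<in> parcs G)"
  have paths: "{p. vpath p (with_proj G) \<and> hd p = s \<and> last p = t} = paths E (pverts G) s t"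
    by (auto simp: vpath_def vwalk_def paths_def E_def set_vwalk_arcs_iff_successively)
  have deg: "deg G v = vdeg E (pverts G) v" for v
  proof -
    have "out_arcs G v = Pair v ` nbrs E (pverts G) v"
      by (auto simp: out_arcs_def nbrs_def E_def image_iff dest: in_arcsD2)
    then show ?thesis
      by (simp add: deg_def out_degree_def vdeg_def card_image inj_on_def)
  qed
  have "symp E" using sym_arcs by (auto simp: E_def symmetric_def intro!: sympI dest: symD)
  moreover have "irreflp E" by (intro irreflpI) (auto simp: E_def dest: pair_no_loops)
  ultimately have "real (npaths E (pverts G) s t) \<le> degree_bound E (pverts G) s"
    using assms by (intro npaths_le_degree_bound) auto
  then show ?thesis
    unfolding path_count_def paths npaths_def degree_bound_def q_bound_def deg .
qed

end
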